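(* Let $k\ge1$ be an odd integer, and let $\chi_1,\chi_2$ be primitive Dirichlet characters modulo $p$ and $q$ respectively, such that either both are non-principal even characters or both are odd characters. Let $a,x>0$. Then for every complex $\nu$ with $\Re(\nu)>0$, \begin{align*} \sum_{n=1}^\infty \sigma_{k,\chi_1,\chi_2}(n)n^{\frac{\nu}{2}}K_\nu(a\sqrt{nx})=\frac{(-1)^{\frac{k+1}{2}}(aq)^\nu p^{\nu+k} x^{\frac{\nu}{2}}}{2^{3\nu+k+2}\pi^{2\nu+k+1}} \tau(\chi_1)\tau(\chi_2)\Gamma(\nu+k+1)\sum_{n=1}^\infty \frac{\sigma_{k,\bar{\chi}_2,\bar{\chi}_1}(n)} {\left( n+\frac{a^2pqx}{16\pi^2} \right)^{\nu+k+1} }. \end{align*}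
   Context: For Dirichlet characters $\chi_1,\chi_2$ and $z\in\mathbb{C}$: $\sigma_{z,\chi_1,\chi_2}(n)=\sum_{d\mid n}d^z\chi_1(d)\chi_2(n/d)$. $\tau(\chi)=\sum_{h=1}^q\chi(h)e^{2\pi i h/q}$ is the Gauss sum of a character $\chi$ modulo $q$, and $K_\nu$ is the modified Bessel function of the second kind. *)

theory Defs
  imports "HOL-Analysis.Analysis"
begin

definition dirichlet_character :: "nat \<Rightarrow> (int \<Rightarrow> complex) \<Rightarrow> bool" where
  "dirichlet_character q chi \<longleftrightarrow> q > 0 \<and>
     (\<forall>m n. chi (m * n) = chi m * chi n) \<and>
     (\<forall>n. chi (n + int q) = chi n) \<and>
     (\<forall>n. chi n \<noteq> 0 \<longleftrightarrow> coprime n (int q))"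

definition principal_character :: "nat \<Rightarrow> (int \<Rightarrow> complex) \<Rightarrow> bool" where
  "principal_character q chi \<longleftrightarrow> (\<forall>n. chi n = (if coprime n (int q) then 1 else 0))"

definition even_character :: "(int \<Rightarrow> complex) \<Rightarrow> bool" where
  "even_character chi \<longleftrightarrow> chi (-1) = 1"

definition odd_character :: "(int \<Rightarrow> complex) \<Rightarrow> bool" where
  "odd_character chi \<longleftrightarrow> chi (-1) = -1"

text \<open>Primitive: q is the conductor, i.e. for no proper divisor d of q is chi induced by a
character mod d (equivalently, chi is not identically 1 on units n with n = 1 mod d).\<close>
definition primitive_character :: "nat \<Rightarrow> (int \<Rightarrow> complex) \<Rightarrow> bool" where
  "primitive_character q chi \<longleftrightarrow> dirichlet_character q chi \<and>
     (\<forall>d::nat. d dvd q \<and> d < q \<longrightarrow>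
        (\<exists>n. coprime n (int q) \<and> n mod int d = 1 mod int d \<and> chi n \<noteq> 1))"

definition sigma_chi :: "complex \<Rightarrow> (int \<Rightarrow> complex) \<Rightarrow> (int \<Rightarrow> complex) \<Rightarrow> nat \<Rightarrow> complex" where
  "sigma_chi z chi1 chi2 n =
     (\<Sum>d\<in>{d. d dvd n}. of_nat d powr z * chi1 (int d) * chi2 (int (n div d)))"

definition gauss_sum :: "nat \<Rightarrow> (int \<Rightarrow> complex) \<Rightarrow> complex" where
  "gauss_sum q chi = (\<Sum>h=1..q. chi (int h) * exp (2 * pi * \<i> * of_nat h / of_nat q))"

text \<open>Modified Bessel function of the second kind for real argument x > 0 and complex order,
via the standard integral representation K_nu(x) = int_0^oo exp(-x cosh t) cosh(nu t) dt.\<close>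
definition besselK :: "complex \<Rightarrow> real \<Rightarrow> complex" where
  "besselK \<nu> x = integral {0..} (\<lambda>t::real. of_real (exp (- x * cosh t)) * cosh (\<nu> * of_real t))"

end

theory Submission
  imports Defs "HOL-Number_Theory.Number_Theory"
begin

text \<open>
  Write \<open>n\<^sup>\<nu>\<^sup>/\<^sup>2 K\<^sub>\<nu>(a \<surd>(n x))\<close> as a constant times the integral of
  \<open>t\<^sup>-\<^sup>\<nu>\<^sup>-\<^sup>1 exp (- n t - a\<^sup>2 x / (4 t))\<close> over \<open>t > 0\<close>. Summing over \<open>n\<close> produces the Eisenstein
  series \<open>\<Sum> \<sigma>\<^sub>k(n) exp (- n t)\<close> of weight \<open>k + 1\<close>, whose behaviour under \<open>t \<mapsto> 4 \<pi>\<^sup>2 / (p q t)\<close>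
  turns the integrals into Gamma integrals, and these give the right-hand side term by term.

  For the transformation of the Eisenstein series, the Lipschitz formula together with the Gauss sum
  expansion of a primitive character rewrites it as an iterated sum of
  \<open>\<chi>(r) \<psi>(m) (r / p + i m y)\<^sup>-\<^sup>k\<^sup>-\<^sup>1\<close> over all integers \<open>r\<close> and \<open>m\<close>; exchanging the two summations exchanges
  the roles of the two characters. The exchange is legitimate even for \<open>k = 1\<close>, because the characters
  are non-principal and therefore sum to zero over a period.
\<close>

subsection \<open>Characters and Gauss sums\<close>

text \<open>Primitivity enters through the separability of Gauss sums: the residue class sums
  produced by the Lipschitz formula collapse to \<open>gauss_sum\<close> times a conjugate character
  value, at non-coprime arguments too. Because of this conjugation the lattice sum carries the
  conjugate of \<open>chi1\<close>; its Lambert series then has \<open>chi1\<close> itself, and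
  \<tau>(chi1) \<tau>(cnj chi1) = chi1(-1) p moves that Gauss sum to the other side at the price of
  a factor 1/p. Since k + 1 is even and the characters have equal parity, the inner sums times the
  outer character are even in m, so a sum over all integers is twice one over positive integers; for
  opposite parities it would cancel. The iterated sum that is regrouped before the exchange
  converges by the exponential decay of the Lambert series. All integrals are taken over the real
  line in the variable v = ln t: there t \<mapsto> 1/t becomes a reflection, scaling becomes a
  translation, and termwise integration meets no endpoint.\<close>

lemma periodic_add_mult:
  fixes f :: "int \<Rightarrow> 'a" and q :: nat
  assumes "\<And>n. f (n + int q) = f n"
  shows "f (n + int q * j) = f n"
proof (induction j rule: int_induct[where k = 0])
  case (step1 i)
  have "f (n + int q * (i + 1)) = f ((n + int q * i) + int q)"
    by (simp add: algebra_simps)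
  with step1 assms show ?case by simp
next
  case (step2 i)
  have "f (n + int q * i) = f ((n + int q * (i - 1)) + int q)"
    by (simp add: algebra_simps)
  with step2 assms show ?case by simp
qed auto

lemma periodic_mod:
  fixes f :: "int \<Rightarrow> 'a" and q :: nat
  assumes "\<And>n. f (n + int q) = f n"
  shows "f (n mod int q) = f n"
  using periodic_add_mult[of f q, OF assms, of "n mod int q" "n div int q"] by simp

text \<open>Multiplication by a unit permutes the residues modulo q, and periodicity identifies each
  product with its residue.\<close>

lemma sum_residues_mult:
  fixes f :: "int \<Rightarrow> complex" and q :: nat
  assumes per: "\<And>n. f (n + int q) = f n" and "q > 0" and cop: "coprime n (int q)"
  shows "(\<Sum>h\<in>{0..<int q}. f (n * h)) = (\<Sum>h\<in>{0..<int q}. f h)"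
proof -
  have inj: "inj_on (\<lambda>h. (n * h) mod int q) {0..<int q}"
  proof (rule inj_onI)
    fix a b assume a: "a \<in> {0..<int q}" and b: "b \<in> {0..<int q}"
      and eq: "(n * a) mod int q = (n * b) mod int q"
    have "[n * a = n * b] (mod int q)" using eq by (simp add: cong_def)
    hence "[a = b] (mod int q)" using cop by (simp add: cong_mult_lcancel)
    thus "a = b" using a b by (simp add: cong_def)
  qed
  have sub: "(\<lambda>h. (n * h) mod int q) ` {0..<int q} \<subseteq> {0..<int q}"
    using \<open>q > 0\<close> by auto
  have "bij_betw (\<lambda>h. (n * h) mod int q) {0..<int q} {0..<int q}"
    using inj sub by (simp add: bij_betw_def endo_inj_surj)
  hence "(\<Sum>h\<in>{0..<int q}. f ((n * h) mod int q)) = (\<Sum>h\<in>{0..<int q}. f h)"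
    by (rule sum.reindex_bij_betw)
  thus ?thesis by (simp add: periodic_mod[of f q, OF per])
qed

lemma dirichlet_character_1:
  assumes "dirichlet_character q chi" shows "chi 1 = 1"
proof -
  have "chi (1 * 1) = chi 1 * chi 1" "chi 1 \<noteq> 0"
    using assms unfolding dirichlet_character_def by (blast, simp)
  thus ?thesis by simp
qed

lemma dirichlet_character_pow:
  assumes "dirichlet_character q chi" shows "chi (n ^ e) = chi n ^ e"
proof (induction e)
  case (Suc e)
  have "chi (n * n ^ e) = chi n * chi (n ^ e)"
    using assms unfolding dirichlet_character_def by blast
  with Suc show ?case by simp
qed (simp add: dirichlet_character_1[OF assms])

text \<open>By Euler's theorem \<open>chi n\<close> is a root of unity: its power with exponent
  \<open>totient q\<close> is \<open>chi 1\<close>. As \<open>euler_theorem\<close> speaks of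
  naturals, n is first replaced by its residue m.\<close>

lemma dirichlet_character_norm:
  assumes "dirichlet_character q chi" and "coprime n (int q)"
  shows "norm (chi n) = 1"
proof -
  have q: "q > 0" and per: "\<And>n. chi (n + int q) = chi n"
    using assms by (auto simp: dirichlet_character_def)
  define m where "m = nat (n mod int q)"
  have m: "int m = n mod int q" using q by (simp add: m_def)
  have cop: "coprime m q"
  proof -
    have "coprime (int m) (int q)" using assms(2) q by (simp add: m)
    thus ?thesis by simp
  qed
  hence "[m ^ totient q = 1] (mod q)" by (rule euler_theorem)
  hence *: "int (m ^ totient q) mod int q = 1 mod int q"
    by (simp only: cong_int_iff[symmetric] cong_def of_nat_1)
  have "chi n = chi (int m)" using periodic_mod[of chi q, OF per, of n] m by simp
  hence "chi n ^ totient q = chi (int (m ^ totient q))"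
    by (simp add: dirichlet_character_pow[OF assms(1)])
  also have "\<dots> = chi (1 mod int q)"
    using periodic_mod[of chi q, OF per, of "int (m ^ totient q)"] * by simp
  also have "\<dots> = 1"
    using periodic_mod[of chi q, OF per, of 1] dirichlet_character_1[OF assms(1)] by simp
  finally have "norm (chi n) ^ totient q = 1" by (metis norm_power norm_one)
  moreover have "totient q > 0" using q by simp
  ultimately show ?thesis
    using power_eq_iff_eq_base[of "totient q" "norm (chi n)" 1] by simp
qed

lemma dirichlet_character_norm_le:
  assumes "dirichlet_character q chi" shows "norm (chi n) \<le> 1"
proof (cases "coprime n (int q)")
  case False
  hence "chi n = 0" using assms by (auto simp: dirichlet_character_def)
  thus ?thesis by simp
qed (use dirichlet_character_norm[OF assms] in auto)

lemma dirichlet_character_cnj_mult: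
  assumes "dirichlet_character q chi" and "coprime n (int q)"
  shows "cnj (chi n) * chi n = 1"
  using dirichlet_character_norm[OF assms] complex_norm_square[of "chi n"]
  by (simp add: mult.commute)

lemma dirichlet_character_0:
  assumes "dirichlet_character q chi" and "q \<noteq> 1" shows "chi 0 = 0"
proof -
  have "\<not> coprime 0 (int q)" using assms(2) by simp
  thus ?thesis using assms(1) unfolding dirichlet_character_def by blast
qed

lemma dirichlet_character_cnj:
  assumes "dirichlet_character q chi" shows "dirichlet_character q (\<lambda>n. cnj (chi n))"
  using assms unfolding dirichlet_character_def by auto

lemma primitive_character_cnj:
  assumes "primitive_character q chi" shows "primitive_character q (\<lambda>n. cnj (chi n))"
  using assms dirichlet_character_cnj unfolding primitive_character_def
  by (metis complex_cnj_one_iff)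

lemma dirichlet_character_mod_1:
  assumes "dirichlet_character 1 chi" shows "chi n = 1"
proof -
  have "chi (1 + int 1 * (n - 1)) = chi 1"
    using assms by (intro periodic_add_mult) (auto simp: dirichlet_character_def)
  thus ?thesis using dirichlet_character_1[OF assms] by simp
qed

section \<open>Additive characters and Gauss sums of primitive characters\<close>

definition additive_character :: "nat \<Rightarrow> int \<Rightarrow> complex" where
  "additive_character q n = exp (2 * pi * \<i> * of_int n / of_nat q)"

lemma additive_character_add:
  "additive_character q (m + n) = additive_character q m * additive_character q n"
  by (simp add: additive_character_def exp_add[symmetric] add_divide_distrib ring_distribs)

lemma additive_character_multiple:
  assumes "q > 0" shows "additive_character q (int q * j) = 1"
  using assms exp_integer_2pi[of "of_int j"] by (simp add: additive_character_def mult_ac)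

lemma additive_character_periodic:
  assumes "q > 0" shows "additive_character q (n + int q * j) = additive_character q n"
  using additive_character_multiple[OF assms] by (simp add: additive_character_add)

lemma additive_character_eq_1_iff:
  assumes "q > 0" shows "additive_character q n = 1 \<longleftrightarrow> int q dvd n"
proof
  assume "additive_character q n = 1"
  then obtain j :: int where "Im (2 * pi * \<i> * of_int n / of_nat q) = of_int (2 * j) * pi"
    unfolding additive_character_def exp_eq_1 by auto
  hence "of_int n = (of_int (j * int q) :: real)"
    using assms by (simp add: Im_divide_of_nat field_simps)
  hence "n = j * int q" by (simp only: of_int_eq_iff)
  thus "int q dvd n" by simp
qed (use additive_character_multiple[OF assms] in auto)

lemma additive_character_mult_nat:
  "additive_character q (int h * n) = additive_character q n ^ h"
  by (simp add: additive_character_def exp_of_nat_mult[symmetric] mult_ac)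

lemma sum_additive_character:
  assumes "q > 0"
  shows "(\<Sum>h\<in>{0..<int q}. additive_character q (h * n)) = (if int q dvd n then of_nat q else 0)"
proof -
  have "(\<Sum>h\<in>{0..<int q}. additive_character q (h * n)) = (\<Sum>h<q. additive_character q n ^ h)"
    by (rule sum.reindex_bij_witness[of _ int nat])
       (auto simp flip: additive_character_mult_nat)
  also have "\<dots> = (if int q dvd n then of_nat q else 0)"
  proof (cases "int q dvd n")
    case False
    hence "additive_character q n \<noteq> 1" using additive_character_eq_1_iff[OF assms] by simp
    moreover have "additive_character q n ^ q = 1"
      using additive_character_multiple[OF assms, of n] by (simp add: additive_character_mult_nat)
    ultimately show ?thesis using False by (simp add: geometric_sum)
  qed (use additive_character_eq_1_iff[OF assms, of n] in simp)
  finally show ?thesis .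
qed

text \<open>The range starts at 0, unlike that of \<open>gauss_sum\<close>, so that it is the image
  of reduction modulo q; at d = 1 periodicity identifies the two sums.\<close>

definition twisted_gauss_sum :: "nat \<Rightarrow> (int \<Rightarrow> complex) \<Rightarrow> int \<Rightarrow> complex" where
  "twisted_gauss_sum q chi d = (\<Sum>h\<in>{0..<int q}. chi h * additive_character q (h * d))"

lemma gauss_sum_eq_twisted:
  assumes "dirichlet_character q chi"
  shows "gauss_sum q chi = twisted_gauss_sum q chi 1"
proof -
  define g where "g h = chi h * additive_character q h" for h
  have q: "q > 0" using assms by (simp add: dirichlet_character_def)
  have "gauss_sum q chi = (\<Sum>h=1..q. g (int h))"
    by (simp add: gauss_sum_def g_def additive_character_def)
  also have "\<dots> = (\<Sum>h=1..<q. g (int h)) + g (int q)"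
    using q by (subst atLeastLessThanSuc_atLeastAtMost[symmetric]) simp
  also have "g (int q) = g 0"
  proof -
    have "chi (0 + int q) = chi 0" using assms unfolding dirichlet_character_def by blast
    thus ?thesis using additive_character_periodic[OF q, of 0 1] by (simp add: g_def)
  qed
  also have "(\<Sum>h=1..<q. g (int h)) + g 0 = (\<Sum>h<q. g (int h))"
    using q by (simp add: lessThan_atLeast0 sum.atLeast_Suc_lessThan add.commute)
  also have "\<dots> = (\<Sum>h\<in>{0..<int q}. g h)"
    by (rule sum.reindex_bij_witness[of _ nat int]) auto
  finally show ?thesis by (simp add: twisted_gauss_sum_def g_def)
qed

text \<open>Substitute n * h for h in a complete residue system; multiplicativity pulls out
  \<open>chi n\<close>.\<close>

lemma twisted_gauss_sum_scale:
  assumes "dirichlet_character q chi" and "coprime n (int q)"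
  shows "chi n * twisted_gauss_sum q chi (n * d) = twisted_gauss_sum q chi d"
proof -
  have q: "q > 0" using assms by (simp add: dirichlet_character_def)
  define g where "g h = chi h * additive_character q (h * d)" for h
  have "chi n * twisted_gauss_sum q chi (n * d) = (\<Sum>h\<in>{0..<int q}. g (n * h))"
    using assms by (simp add: twisted_gauss_sum_def g_def sum_distrib_left
        dirichlet_character_def mult_ac)
  also have "\<dots> = (\<Sum>h\<in>{0..<int q}. g h)"
  proof (rule sum_residues_mult[OF _ q assms(2)])
    fix h show "g (h + int q) = g h"
      using assms additive_character_periodic[OF q, of "h * d" d]
      by (simp add: g_def dirichlet_character_def ring_distribs)
  qed
  finally show ?thesis by (simp add: twisted_gauss_sum_def g_def)
qed

text \<open>For a unit d this is the substitution above. Otherwise put g = gcd(d, q) > 1: a unit n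
  congruent to 1 modulo q/g satisfies n * d \<equiv> d modulo q, so the twisted sum is unchanged
  under multiplication by \<open>chi n\<close>. Primitivity supplies such an n with
  \<open>chi n \<noteq> 1\<close>, hence the sum is 0, as is \<open>chi d\<close>.\<close>

lemma twisted_gauss_sum_primitive:
  assumes "primitive_character q chi"
  shows "twisted_gauss_sum q chi d = cnj (chi d) * gauss_sum q chi"
proof -
  have chi: "dirichlet_character q chi" using assms by (simp add: primitive_character_def)
  hence q: "q > 0" by (simp add: dirichlet_character_def)
  show ?thesis
  proof (cases "coprime d (int q)")
    case True
    have "cnj (chi d) * gauss_sum q chi = cnj (chi d) * (chi d * twisted_gauss_sum q chi (d * 1))"
      using twisted_gauss_sum_scale[OF chi True, of 1] gauss_sum_eq_twisted[OF chi] by simp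
    also have "\<dots> = twisted_gauss_sum q chi d"
      using dirichlet_character_cnj_mult[OF chi True] by (simp flip: mult.assoc)
    finally show ?thesis by simp
  next
    case False
    define g where "g = gcd d (int q)"
    define r where "r = nat (int q div g)"
    have g: "g > 1" using False q 
  proof -
    have "g > 0" "g \<noteq> 1" using False q by (auto simp: g_def coprime_iff_gcd_eq_1)
    thus ?thesis by linarith
  qed
    have gr: "int q = g * int r" using g q 
  proof -
    have "int q div g \<ge> 0" using g by (simp add: pos_imp_zdiv_nonneg_iff)
    moreover have "g dvd int q" by (simp add: g_def)
    ultimately show ?thesis by (simp add: r_def)
  qed
    have "int r > 0" using gr q by (cases "r = 0") auto
    hence "int r < int q" using gr g by simp
    moreover have "r dvd q" 
    proof -
      have "int r dvd int q" unfolding gr by simp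
      thus ?thesis by (simp only: int_dvd_int_iff)
    qed
    ultimately obtain n where n: "coprime n (int q)" "n mod int r = 1 mod int r" "chi n \<noteq> 1"
      using assms unfolding primitive_character_def by auto
    have "int r dvd n - 1" using n(2) by (simp add: mod_eq_dvd_iff)
    hence "int r * g dvd (n - 1) * d" unfolding g_def by (intro mult_dvd_mono) auto
    then obtain j where "(n - 1) * d = int q * j" unfolding gr by (metis dvdE mult.commute)
    hence nd: "n * d = d + int q * j" by (simp add: algebra_simps)
    have "additive_character q (h * (n * d)) = additive_character q (h * d)" for h
      using additive_character_periodic[OF q, of "h * d" "h * j"]
      unfolding nd by (simp add: algebra_simps)
    hence "twisted_gauss_sum q chi (n * d) = twisted_gauss_sum q chi d"
      by (simp add: twisted_gauss_sum_def)
    hence "chi n * twisted_gauss_sum q chi d = twisted_gauss_sum q chi d"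
      using twisted_gauss_sum_scale[OF chi n(1), of d] by simp
    hence "twisted_gauss_sum q chi d = 0" using n(3) by simp
    moreover have "chi d = 0" using False chi by (auto simp: dirichlet_character_def)
    ultimately show ?thesis by simp
  qed
qed

text \<open>Separability at d = 0, where the additive character is trivial and
  \<open>chi 0 = 0\<close>.\<close>

lemma primitive_character_sum_eq_0:
  assumes "primitive_character q chi" and "q \<noteq> 1"
  shows "(\<Sum>h\<in>{0..<int q}. chi h) = 0"
proof -
  have "chi 0 = 0" using assms dirichlet_character_0 unfolding primitive_character_def by blast
  thus ?thesis using twisted_gauss_sum_primitive[OF assms(1), of 0]
    by (simp add: twisted_gauss_sum_def additive_character_def)
qed

text \<open>Separability absorbs \<open>cnj (chi h)\<close> into the first Gauss sum as its twist by
  h. Summing over h first, orthogonality of the additive characters leaves only the residue j =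
  -1.\<close>

lemma gauss_sum_mult_cnj:
  assumes "primitive_character q chi"
  shows "gauss_sum q chi * gauss_sum q (\<lambda>n. cnj (chi n)) = chi (-1) * of_nat q"
proof -
  have chi: "dirichlet_character q chi" using assms by (simp add: primitive_character_def)
  hence q: "q > 0" and per: "\<And>n. chi (n + int q) = chi n" by (auto simp: dirichlet_character_def)
  have "gauss_sum q chi * gauss_sum q (\<lambda>n. cnj (chi n)) =
      (\<Sum>h\<in>{0..<int q}. (cnj (chi h) * gauss_sum q chi) * additive_character q h)"
    unfolding gauss_sum_eq_twisted[OF dirichlet_character_cnj[OF chi]]
    by (simp add: twisted_gauss_sum_def sum_distrib_left mult_ac)
  also have "\<dots> = (\<Sum>h\<in>{0..<int q}. \<Sum>j\<in>{0..<int q}. chi j * additive_character q (h * (j + 1)))"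
    by (simp add: twisted_gauss_sum_primitive[OF assms, symmetric] twisted_gauss_sum_def
        sum_distrib_right sum_distrib_left ring_distribs additive_character_add mult_ac)
  also have "\<dots> = (\<Sum>j\<in>{0..<int q}. chi j * (\<Sum>h\<in>{0..<int q}. additive_character q (h * (j + 1))))"
    by (subst sum.swap) (simp add: sum_distrib_left)
  also have "\<dots> = (\<Sum>j\<in>{0..<int q}. if j = int q - 1 then chi j * of_nat q else 0)"
  proof (rule sum.cong[OF refl])
    fix j assume j: "j \<in> {0..<int q}"
    have "int q dvd j + 1 \<longleftrightarrow> j = int q - 1"
      using j zdvd_imp_le[of "int q" "j + 1"] by auto
    thus "chi j * (\<Sum>h\<in>{0..<int q}. additive_character q (h * (j + 1))) =
        (if j = int q - 1 then chi j * of_nat q else 0)"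
      by (simp add: sum_additive_character[OF q])
  qed
  also have "\<dots> = chi (int q - 1) * of_nat q" using q by simp
  also have "chi (int q - 1) = chi (-1)" using per[of "-1"] by simp
  finally show ?thesis .
qed

subsection \<open>The Lipschitz formula\<close>

lemma summable_on_int_powr:
  assumes "s > 1"
  shows "(\<lambda>n::int. (1 + \<bar>real_of_int n\<bar>) powr (-s)) summable_on UNIV"
proof -
  have "summable (\<lambda>n. real (Suc n) powr (-s))"
    using assms by (subst summable_Suc_iff) (simp add: summable_real_powr_iff)
  hence nat: "(\<lambda>n::nat. (1 + real n) powr (-s)) summable_on UNIV"
    by (simp add: summable_on_UNIV_nonneg_real_iff add.commute)
  have "(\<lambda>n::int. (1 + \<bar>real_of_int n\<bar>) powr (-s)) summable_on (range int)"
    using nat by (subst summable_on_reindex) (auto simp: o_def)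
  moreover have "(\<lambda>n::int. (1 + \<bar>real_of_int n\<bar>) powr (-s)) summable_on (range (\<lambda>n. - int n))"
    using nat by (subst summable_on_reindex) (auto simp: o_def inj_on_def)
  ultimately have "(\<lambda>n::int. (1 + \<bar>real_of_int n\<bar>) powr (-s)) summable_on
      (range int \<union> range (\<lambda>n. - int n))"
    by (rule summable_on_union)
  moreover have "range int \<union> range (\<lambda>n. - int n) = UNIV"
  proof -
    have "n \<in> range int \<union> range (\<lambda>n. - int n)" for n
      by (cases n rule: int_cases2) auto
    thus ?thesis by blast
  qed
  ultimately show ?thesis by simp
qed

text \<open>A linear lower bound on the modulus of \<open>w n\<close> is all that later sums have to
  supply; it also forces \<open>w n \<noteq> 0\<close> and C > 0. Convergence needs only two of the
  K powers.\<close>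

lemma summable_on_int_inverse_power:
  fixes w :: "int \<Rightarrow> complex"
  assumes bound: "\<And>n. 1 + \<bar>real_of_int n\<bar> \<le> C * norm (w n)" and "K \<ge> 2"
  shows "(\<lambda>n. inverse (w n ^ K)) summable_on UNIV"
proof -
  have C: "C > 0"
    using bound[of 0] mult_nonpos_nonneg[of C "norm (w 0)"] by (cases "C > 0") auto
  have "(\<lambda>n. C ^ K * (1 + \<bar>real_of_int n\<bar>) powr (-2)) summable_on UNIV"
    by (intro summable_on_cmult_right summable_on_int_powr) simp
  hence "(\<lambda>n. norm (inverse (w n ^ K))) summable_on UNIV"
  proof (rule summable_on_comparison_test)
    fix n :: int
    define b where "b = 1 + \<bar>real_of_int n\<bar>"
    have b: "b \<ge> 1" "b \<le> C * norm (w n)" using bound[of n] by (auto simp: b_def)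
    have w: "norm (w n) > 0"
      using b by (cases "w n = 0") auto
    have "norm (inverse (w n ^ K)) = inverse (norm (w n)) ^ K"
      by (simp add: norm_inverse norm_power power_inverse)
    also have "\<dots> \<le> (C / b) ^ K"
      using b w by (intro power_mono) (auto simp: field_simps)
    also have "\<dots> = C ^ K * inverse (b ^ K)" by (simp add: power_divide field_simps)
    also have "\<dots> \<le> C ^ K * inverse (b ^ 2)"
      using b C \<open>K \<ge> 2\<close> by (intro mult_left_mono le_imp_inverse_le power_increasing) auto
    also have "inverse (b ^ 2) = b powr (-2)"
      using b by (simp add: powr_minus)
    finally show "norm (inverse (w n ^ K)) \<le> C ^ K * (1 + \<bar>real_of_int n\<bar>) powr (-2)"
      by (simp add: b_def)
  qed auto
  thus ?thesis by (rule abs_summable_summable)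
qed

text \<open>Termwise differentiation preserves the disc of convergence, and \<open>diffs\<close>
  turns n^k into (n+1)^(k+1); a factor w restores the exponent. The induction generalises over w
  because \<open>termdiff_converges\<close> asks for convergence in the whole disc.\<close>

lemma summable_pow_mult_geometric:
  fixes w :: "'a :: {real_normed_field, banach}"
  assumes "norm w < 1"
  shows "summable (\<lambda>n. of_nat n ^ k * w ^ n)"
  using assms
proof (induction k arbitrary: w)
  case (Suc k)
  have "summable (\<lambda>n. diffs (\<lambda>n. of_nat n ^ k) n * w ^ n)"
    by (rule termdiff_converges[OF Suc.prems]) (rule Suc.IH)
  hence "summable (\<lambda>n. w * (of_nat (Suc n) ^ Suc k * w ^ n))"
    by (intro summable_mult) (simp add: diffs_def)
  hence "summable (\<lambda>n. of_nat (Suc n) ^ Suc k * w ^ Suc n)"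
    by (simp add: mult_ac)
  thus ?case by (subst (asm) summable_Suc_iff)
qed (simp add: summable_geometric)

lemma has_field_derivative_exp_series:
  fixes z :: complex
  assumes "Im z > 0"
  shows "((\<lambda>z. \<Sum>n. of_nat n ^ k * exp (2 * pi * \<i> * z) ^ n) has_field_derivative
           2 * pi * \<i> * (\<Sum>n. of_nat n ^ Suc k * exp (2 * pi * \<i> * z) ^ n)) (at z)"
proof -
  define w where "w = exp (2 * pi * \<i> * z)"
  have w: "norm w < 1" using assms by (simp add: w_def)
  have "((\<lambda>w. \<Sum>n. of_nat n ^ k * w ^ n) has_field_derivative
      (\<Sum>n. diffs (\<lambda>n. of_nat n ^ k) n * w ^ n)) (at w)"
    by (rule termdiffs_strong'[OF _ w]) (rule summable_pow_mult_geometric)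
  hence "((\<lambda>z. \<Sum>n. of_nat n ^ k * exp (2 * pi * \<i> * z) ^ n) has_field_derivative
      (\<Sum>n. diffs (\<lambda>n. of_nat n ^ k) n * w ^ n) * (2 * pi * \<i> * w)) (at z)"
    unfolding w_def by (rule DERIV_chain2) (auto intro!: derivative_eq_intros)
  also have "(\<Sum>n. diffs (\<lambda>n. of_nat n ^ k) n * w ^ n) * (2 * pi * \<i> * w) =
      2 * pi * \<i> * (w * (\<Sum>n. of_nat (Suc n) ^ Suc k * w ^ n))"
    by (simp add: diffs_def mult_ac)
  also have "w * (\<Sum>n. of_nat (Suc n) ^ Suc k * w ^ n) =
      (\<Sum>n. of_nat (Suc n) ^ Suc k * w ^ Suc n)"
  proof -
    have "summable (\<lambda>n. diffs (\<lambda>n. of_nat n ^ k) n * w ^ n)"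
      by (rule termdiff_converges[OF w]) (rule summable_pow_mult_geometric)
    hence "summable (\<lambda>n. of_nat (Suc n) ^ Suc k * w ^ n)" by (simp add: diffs_def)
    from suminf_mult[OF this, of w] show ?thesis by (simp add: mult_ac)
  qed
  \<comment> \<open>Shifting the index costs nothing: the term n = 0 has the factor 0 ^ Suc
    k.\<close>
  also have "\<dots> = (\<Sum>n. of_nat n ^ Suc k * w ^ n)"
    using suminf_split_head[OF summable_pow_mult_geometric[OF w, of "Suc k"]] by simp
  finally show ?thesis by (simp add: w_def)
qed

lemma nonint_of_Im_pos:
  assumes "Im z > 0" shows "z \<notin> \<int>"  "1 - z \<notin> \<int>"
  using assms by (auto elim!: Ints_cases simp: complex_eq_iff)

text \<open>Logarithmic differentiation of \<Gamma>(z) \<Gamma>(1 - z) = \<pi> / sin(\<pi> z), by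
  equating two expressions for one derivative. Off the real axis there are neither poles nor zeros
  of the sine.\<close>

lemma Digamma_reflection:
  assumes "Im z > 0"
  shows "Digamma z - Digamma (1 - z) = - (of_real pi * cot (of_real pi * z))"
proof -
  define G where "G = Gamma z * Gamma (1 - z)"
  have nz: "sin (of_real pi * z) \<noteq> 0" 
    using nonint_of_Im_pos[OF assms] by (auto simp: sin_eq_0 elim!: Ints_cases)
  have ni: "z \<notin> \<int>\<^sub>\<le>\<^sub>0" "1 - z \<notin> \<int>\<^sub>\<le>\<^sub>0"
    using nonint_of_Im_pos[OF assms] nonpos_Ints_Int by blast+
  have "((\<lambda>z. Gamma z * Gamma (1 - z)) has_field_derivative
      G * (Digamma z - Digamma (1 - z))) (at z)"
    using ni unfolding G_def by (auto intro!: derivative_eq_intros simp: algebra_simps)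
  moreover have "((\<lambda>z. Gamma z * Gamma (1 - z)) has_field_derivative
      - (G * (of_real pi * cot (of_real pi * z)))) (at z)"
  proof -
    have "((\<lambda>z. of_real pi / sin (of_real pi * z)) has_field_derivative
      - (G * (of_real pi * cot (of_real pi * z)))) (at z)"
      unfolding G_def Gamma_reflection_complex using nz
      by (auto intro!: derivative_eq_intros simp: cot_def field_simps)
    thus ?thesis by (simp add: Gamma_reflection_complex)
  qed
  ultimately have "G * (Digamma z - Digamma (1 - z)) = - (G * (of_real pi * cot (of_real pi * z)))"
    by (rule DERIV_unique)
  hence "G * (Digamma z - Digamma (1 - z)) = G * - (of_real pi * cot (of_real pi * z))"
    by (simp only: mult_minus_right)
  moreover have "G \<noteq> 0" using nz unfolding G_def Gamma_reflection_complex by simp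
  ultimately show ?thesis by (metis mult_left_cancel)
qed

text \<open>With e = exp(i \<pi> z) the cotangent is i (e^2 + 1) / (e^2 - 1), and in the upper half
  plane e^2 has modulus below 1, which makes it a geometric series.\<close>

lemma pi_cot_eq_geometric:
  assumes "Im z > 0"
  shows "- (of_real pi * cot (of_real pi * z)) =
           2 * pi * \<i> * (\<Sum>n. exp (2 * pi * \<i> * z) ^ n) - pi * \<i>"
proof -
  define e where "e = exp (\<i> * (of_real pi * z))"
  have e: "exp (2 * pi * \<i> * z) = e * e" "e \<noteq> 0" "exp (- (\<i> * (of_real pi * z))) = inverse e"
    by (simp_all add: e_def exp_add[symmetric] exp_minus mult_ac)
  have w: "norm (e * e) < 1" using assms unfolding e(1)[symmetric] by simp
  hence ne: "e * e \<noteq> 1" by auto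
  have "sin (of_real pi * z) = (e - inverse e) / (2 * \<i>)" "cos (of_real pi * z) = (e + inverse e) / 2"
    by (simp_all add: sin_exp_eq cos_exp_eq e(3)) (simp_all add: e_def)
  hence "cot (of_real pi * z) = ((e + inverse e) / 2) / ((e - inverse e) / (2 * \<i>))"
    by (simp only: cot_def)
  also have "e + inverse e = (e * e + 1) / e" using e(2) by (simp add: field_simps)
  also have "e - inverse e = (e * e - 1) / e" using e(2) by (simp add: field_simps)
  also have "((e * e + 1) / e / 2) / ((e * e - 1) / e / (2 * \<i>)) = \<i> * (e * e + 1) / (e * e - 1)"
    using e(2) ne by (simp add: divide_simps)
  finally have c: "cot (of_real pi * z) = \<i> * (e * e + 1) / (e * e - 1)" .
  have s: "(\<Sum>n. exp (2 * pi * \<i> * z) ^ n) = 1 / (1 - e * e)"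
    unfolding e(1) using w by (rule suminf_geometric)
  have "1 - e * e \<noteq> 0" "e * e - 1 \<noteq> 0" using ne by auto
  thus ?thesis unfolding c s by (simp add: divide_simps) (simp add: algebra_simps)
qed

text \<open>Order 0 combines the two preceding facts. Each further order is one differentiation,
  legitimate since the identity holds on the open upper half plane; the alternating sign is the
  inner derivative of 1 - z, and the constant \<pi> i disappears at the first derivative.\<close>

lemma Polygamma_reflection_exp_series:
  assumes "Im z > 0"
  shows "Polygamma k z + (-1) ^ Suc k * Polygamma k (1 - z) =
     (2 * pi * \<i>) ^ Suc k * (\<Sum>n. of_nat n ^ k * exp (2 * pi * \<i> * z) ^ n)
       - (if k = 0 then pi * \<i> else 0)"
  using assms
proof (induction k arbitrary: z)
  case 0
  thus ?case using Digamma_reflection[of z] pi_cot_eq_geometric[of z] by simp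
next
  case (Suc k)
  define L where "L z = Polygamma k z + (-1) ^ Suc k * Polygamma k (1 - z)" for z :: complex
  define R where "R z = (2 * pi * \<i>) ^ Suc k * (\<Sum>n. of_nat n ^ k * exp (2 * pi * \<i> * z) ^ n)
      - (if k = 0 then pi * \<i> else 0)" for z
  have ni: "z \<notin> \<int>\<^sub>\<le>\<^sub>0" "1 - z \<notin> \<int>\<^sub>\<le>\<^sub>0"
    using nonint_of_Im_pos[OF Suc.prems] nonpos_Ints_Int by blast+
  have "(L has_field_derivative
      Polygamma (Suc k) z + (-1) ^ Suc (Suc k) * Polygamma (Suc k) (1 - z)) (at z)"
    using ni unfolding L_def by (auto intro!: derivative_eq_intros)
  moreover have "(L has_field_derivative
      (2 * pi * \<i>) ^ Suc (Suc k) * (\<Sum>n. of_nat n ^ Suc k * exp (2 * pi * \<i> * z) ^ n)) (at z)"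
  proof (rule has_field_derivative_transform_within_open)
    have "(R has_field_derivative (2 * pi * \<i>) ^ Suc k *
        (2 * pi * \<i> * (\<Sum>n. of_nat n ^ Suc k * exp (2 * pi * \<i> * z) ^ n)) - 0) (at z)"
      unfolding R_def
      by (intro DERIV_diff DERIV_const DERIV_cmult has_field_derivative_exp_series Suc.prems)
    thus "(R has_field_derivative
        (2 * pi * \<i>) ^ Suc (Suc k) * (\<Sum>n. of_nat n ^ Suc k * exp (2 * pi * \<i> * z) ^ n)) (at z)"
      by (simp add: mult_ac)
    show "open {z. Im z > 0}" by (rule open_halfspace_Im_gt)
    show "R z = L z" if "z \<in> {z. Im z > 0}" for z
      using Suc.IH[of z] that by (simp add: L_def R_def)
  qed (use Suc.prems in simp)
  ultimately have "Polygamma (Suc k) z + (-1) ^ Suc (Suc k) * Polygamma (Suc k) (1 - z) =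
      (2 * pi * \<i>) ^ Suc (Suc k) * (\<Sum>n. of_nat n ^ Suc k * exp (2 * pi * \<i> * z) ^ n)"
    by (rule DERIV_unique)
  thus ?case by (simp del: power_Suc)
qed

text \<open>This is the derivative of order \<open>k\<close> of the partial fraction expansion of the cotangent.\<close>

lemma lipschitz_formula:
  assumes "Im z > 0" and "odd k"
  shows "((\<lambda>n::int. inverse ((z + of_int n) ^ Suc k)) has_sum
     ((2 * pi * \<i>) ^ Suc k / fact k * (\<Sum>n. of_nat n ^ k * exp (2 * pi * \<i> * z) ^ n))) UNIV"
proof -
  define f where "f n = inverse ((z + of_int n) ^ Suc k)" for n :: int
  have k: "k > 0" using assms(2) by (cases k) auto
  have z: "z \<noteq> 0" "1 - z \<noteq> 0" using assms(1) by (auto simp: complex_eq_iff)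
  have summ: "f summable_on UNIV" unfolding f_def
  \<comment> \<open>The modulus of z + n is at least Im z, and that of n is at most the sum of those
    of z + n and z. The quotient in C pays for the constants 1 and \<open>norm z\<close>.\<close>
  proof (rule summable_on_int_inverse_power[where C = "1 + (1 + norm z) / Im z"])
    fix n :: int
    have "Im z \<le> norm (z + of_int n)" using abs_Im_le_cmod[of "z + of_int n"] by simp
    hence "(1 + norm z) / Im z * Im z \<le> (1 + norm z) / Im z * norm (z + of_int n)"
      using assms(1) by (intro mult_left_mono) auto
    moreover have "norm (of_int n :: complex) \<le> norm (z + of_int n) + norm z"
      using norm_triangle_ineq4[of "z + of_int n" z] by simp
    moreover have "(1 + norm z) / Im z * Im z = 1 + norm z" using assms(1) by simp
    moreover have "(1 + (1 + norm z) / Im z) * norm (z + of_int n) =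
        norm (z + of_int n) + (1 + norm z) / Im z * norm (z + of_int n)"
      by (simp only: distrib_right mult_1_left)
    moreover have "norm (of_int n :: complex) = \<bar>real_of_int n\<bar>" by simp
    ultimately show "1 + \<bar>real_of_int n\<bar> \<le> (1 + (1 + norm z) / Im z) * norm (z + of_int n)"
      by linarith
  qed (use k in simp)
  have A: "(f has_sum (Polygamma k z / fact k)) (range int)"
  proof -
    have "f summable_on range int" using summ by (rule summable_on_subset_banach) simp
    hence s: "(f \<circ> int) summable_on UNIV" by (simp add: summable_on_reindex)
    \<comment> \<open>\<open>Polygamma_LIMSEQ\<close> gives an ordered sum; unconditional
      summability of \<open>f\<close> upgrades it to \<open>has_sum\<close> with the same
      value.\<close>
    have "(f \<circ> int) sums (Polygamma k z / fact k)"
      using Polygamma_LIMSEQ[OF z(1) k] assms(2) by (simp add: f_def o_def)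
    moreover have hs: "((f \<circ> int) has_sum infsum (f \<circ> int) UNIV) UNIV" using s by (rule has_sum_infsum)
    hence "(f \<circ> int) sums infsum (f \<circ> int) UNIV" by (rule has_sum_imp_sums)
    ultimately have "Polygamma k z / fact k = infsum (f \<circ> int) UNIV" by (rule sums_unique2)
    with hs have "((f \<circ> int) has_sum (Polygamma k z / fact k)) UNIV" by (simp only:)
    thus ?thesis by (subst has_sum_reindex) auto
  qed
  \<comment> \<open>\<open>g\<close> lists the negative integers so that -(z + g n) = 1 - z + n. As
    k + 1 is even the sign is immaterial, and this half is the polygamma series at 1 - z.\<close>
  define g where "g n = -1 - int n" for n
  have injg: "inj g" by (auto simp: g_def inj_on_def)
  have B: "(f has_sum (Polygamma k (1 - z) / fact k)) (range g)"
  proof -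
    have "f summable_on range g" using summ by (rule summable_on_subset_banach) simp
    hence s: "(f \<circ> g) summable_on UNIV" using injg by (simp add: summable_on_reindex)
    have *: "(f \<circ> g) n = inverse ((1 - z + of_nat n) ^ Suc k)" for n
    proof -
      have "(z + of_int (g n)) ^ Suc k = (- (z + of_int (g n))) ^ Suc k"
        using assms(2) by (subst power_minus_even) auto
      also have "- (z + of_int (g n)) = 1 - z + of_nat n" by (simp add: g_def)
      finally show ?thesis by (simp add: f_def)
    qed
    have "(f \<circ> g) sums (Polygamma k (1 - z) / fact k)"
      using Polygamma_LIMSEQ[OF z(2) k] assms(2) unfolding * by simp
    moreover have hs: "((f \<circ> g) has_sum infsum (f \<circ> g) UNIV) UNIV" using s by (rule has_sum_infsum)
    hence "(f \<circ> g) sums infsum (f \<circ> g) UNIV" by (rule has_sum_imp_sums)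
    ultimately have "Polygamma k (1 - z) / fact k = infsum (f \<circ> g) UNIV" by (rule sums_unique2)
    with hs have "((f \<circ> g) has_sum (Polygamma k (1 - z) / fact k)) UNIV" by (simp only:)
    thus ?thesis using injg by (subst has_sum_reindex) auto
  qed
  have "(f has_sum (Polygamma k z / fact k + Polygamma k (1 - z) / fact k)) (range int \<union> range g)"
    by (intro has_sum_Un_disjoint A B) (auto simp: g_def)
  moreover have "range int \<union> range g = UNIV"
  proof -
    have "n \<in> range int \<union> range g" for n
    proof (cases "n \<ge> 0")
      case False
      hence "n = g (nat (-1 - n))" by (simp add: g_def)
      thus ?thesis by blast
    qed (auto intro: range_eqI[of _ _ "nat n"])
    thus ?thesis by blast
  qed
  moreover have "Polygamma k z + Polygamma k (1 - z) =
      (2 * pi * \<i>) ^ Suc k * (\<Sum>n. of_nat n ^ k * exp (2 * pi * \<i> * z) ^ n)"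
    using Polygamma_reflection_exp_series[OF assms(1), of k] assms(2) k by simp
  ultimately show ?thesis unfolding f_def
    by (simp only: add_divide_distrib[symmetric] times_divide_eq_left)
qed

subsection \<open>Lambert series as lattice sums\<close>

lemma summable_on_dominated:
  fixes f g :: "'a \<Rightarrow> complex"
  assumes "g summable_on A" and "\<And>x. x \<in> A \<Longrightarrow> norm (f x) \<le> norm (g x)"
  shows "f summable_on A"
  using assms Infinite_Sum.abs_summable_on_comparison_test[of g A f]
  by (simp add: summable_on_iff_abs_summable_on_complex)

lemma has_sum_finite_sum:
  fixes f :: "'i \<Rightarrow> 'a \<Rightarrow> complex"
  assumes "\<And>i. i \<in> I \<Longrightarrow> (f i has_sum s i) A"
  shows "((\<lambda>x. \<Sum>i\<in>I. f i x) has_sum (\<Sum>i\<in>I. s i)) A"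
  using assms by (induction I rule: infinite_finite_induct) (auto intro!: has_sum_add)

lemma summable_on_Times_nonneg:
  fixes f :: "'a \<Rightarrow> real" and g :: "'b \<Rightarrow> real"
  assumes "f summable_on A" "g summable_on B" "\<And>x. x \<in> A \<Longrightarrow> f x \<ge> 0" "\<And>y. y \<in> B \<Longrightarrow> g y \<ge> 0"
  shows "(\<lambda>(x, y). f x * g y) summable_on A \<times> B"
proof (rule summable_on_SigmaI)
  fix x assume "x \<in> A"
  show "((\<lambda>y. case (x, y) of (x, y) \<Rightarrow> f x * g y) has_sum f x * infsum g B) B"
    using assms(2) by (auto intro!: has_sum_cmult_right)
qed (use assms in \<open>auto intro!: summable_on_cmult_left\<close>)

text \<open>Division with remainder replaces integers by pairs of quotient and residue; the finite
  inner sums are the blocks in which characters cancel.\<close>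

lemma has_sum_residue_blocks:
  fixes g :: "int \<Rightarrow> complex"
  assumes "q > 0" and "g summable_on UNIV"
  shows "((\<lambda>j. \<Sum>b\<in>{0..<int q}. g (b + int q * j)) has_sum infsum g UNIV) UNIV"
proof -
  have "((\<lambda>(j, b). g (b + int q * j)) has_sum infsum g UNIV) (UNIV \<times> {0..<int q}) \<longleftrightarrow>
      (g has_sum infsum g UNIV) UNIV"
    by (rule has_sum_reindex_bij_witness[of _ "\<lambda>n. (n div int q, n mod int q)"
          "\<lambda>(j, b). b + int q * j"]) (use assms(1) in auto)
  hence "((\<lambda>(j, b). g (b + int q * j)) has_sum infsum g UNIV) (UNIV \<times> {0..<int q})"
    using assms(2) by simp
  thus ?thesis by (rule has_sum_SigmaD) (auto intro!: has_sum_finiteI)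
qed

lemma exp_ge_power:
  fixes x :: real assumes "x \<ge> 0" shows "x ^ N / fact N \<le> exp x"
proof -
  have "(\<Sum>n\<in>{N}. inverse (fact n) *\<^sub>R x ^ n) \<le> exp x"
    unfolding exp_def using assms by (intro sum_le_suminf summable_exp_generic) auto
  thus ?thesis by (simp add: field_simps)
qed

lemma exp_minus_le_power:
  fixes x :: real assumes "x > 0" shows "exp (-x) \<le> fact N / x ^ N"
  using exp_ge_power[of x N] assms by (simp add: exp_minus field_simps)

text \<open>In a pair (m, n) the second entry is the divisor, carrying the power k and
  \<open>chi\<close>, and the first is the cofactor, carrying \<open>psi\<close>. Collecting pairs
  with equal product gives coefficients \<open>sigma_chi\<close>; leaving them uncollected matches
  the lattice sum, one m at a time.\<close>

definition double_lambert :: "nat \<Rightarrow> (int \<Rightarrow> complex) \<Rightarrow> (int \<Rightarrow> complex) \<Rightarrow> real \<Rightarrow> nat \<times> nat \<Rightarrow> complex"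
  where "double_lambert k chi psi t =
    (\<lambda>(m, n). of_nat n ^ k * chi (int n) * psi (int m) * of_real (exp (- (t * real n * real m))))"

lemma summable_on_inverse_square: "(\<lambda>n::nat. inverse (real n ^ 2)) summable_on {1..}"
proof -
  have "summable (\<lambda>n. inverse (real n ^ 2))" by (rule inverse_power_summable) simp
  hence "(\<lambda>n::nat. inverse (real n ^ 2)) summable_on UNIV"
    by (intro summable_nonneg_imp_summable_on) auto
  thus ?thesis by (rule summable_on_subset_banach) simp
qed

text \<open>With N = k + 2 the bound exp(-x) \<le> N! / x^N leaves n^(-2) m^(-k-2), dominated by a
  product of inverse squares.\<close>

lemma double_lambert_summable:
  assumes chi: "\<And>n. norm (chi n) \<le> 1" and psi: "\<And>n. norm (psi n) \<le> 1" and t: "t > 0"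
  shows "double_lambert k chi psi t summable_on {1..} \<times> {1..}"
proof -
  define N where "N = k + 2"
  define C where "C = fact N / t ^ N"
  have C: "C \<ge> 0" using t by (simp add: C_def)
  have "(\<lambda>(m, n). inverse (real m ^ 2) * inverse (real n ^ 2)) summable_on {1..} \<times> {1..}"
    by (intro summable_on_Times_nonneg summable_on_inverse_square) auto
  hence "(\<lambda>x. C * (case x of (m, n) \<Rightarrow> inverse (real m ^ 2) * inverse (real n ^ 2))) summable_on {1..} \<times> {1..}"
    by (intro summable_on_cmult_right) auto
  hence "(\<lambda>x. norm (double_lambert k chi psi t x)) summable_on {1..} \<times> {1..}"
  proof (rule Infinite_Sum.abs_summable_on_comparison_test')
    fix x :: "nat \<times> nat" assume "x \<in> {1..} \<times> {1..}"
    then obtain m n where x: "x = (m, n)" and "1 \<le> m" "1 \<le> n" by auto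
    hence mn: "real m \<ge> 1" "real n \<ge> 1" by auto
    have "norm (double_lambert k chi psi t (m, n)) =
        norm (chi (int n)) * norm (psi (int m)) * (real n ^ k * exp (- (t * real n * real m)))"
      by (simp add: double_lambert_def norm_mult norm_power)
    also have "\<dots> \<le> 1 * (real n ^ k * (fact N / (t * real n * real m) ^ N))"
      using mn t chi psi by (intro mult_mono exp_minus_le_power mult_le_one) auto
    also have "\<dots> = C * (real n ^ k / real n ^ N) * inverse (real m ^ N)"
      by (simp add: C_def power_mult_distrib field_simps)
    also have "real n ^ k / real n ^ N = inverse (real n ^ 2)"
      using mn by (simp add: N_def power_add field_simps power2_eq_square)
    also have "C * inverse (real n ^ 2) * inverse (real m ^ N) \<le>
        C * inverse (real n ^ 2) * inverse (real m ^ 2)"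
      using mn C by (intro mult_left_mono le_imp_inverse_le power_increasing) (auto simp: N_def)
    finally show "norm (double_lambert k chi psi t x) \<le>
        C * (case x of (m, n) \<Rightarrow> inverse (real m ^ 2) * inverse (real n ^ 2))"
      by (simp add: x mult_ac)
  qed
  thus ?thesis by (rule abs_summable_summable)
qed

text \<open>Splitting r by its residue b modulo q reduces the sum to the Lipschitz formula at b/q +
  i y. The exponential series then contains exp(2 \<pi> i b n / q), so summing over b yields a Gauss
  sum twisted by n, which separability reduces to \<open>cnj (chi n)\<close>.\<close>

lemma lipschitz_formula_character:
  assumes prim: "primitive_character q chi" and y: "y > 0" and k: "odd k"
  defines "w \<equiv> (\<lambda>r::int. of_int r / of_nat q + \<i> * of_real y)"
  shows "((\<lambda>r. chi r * inverse (w r ^ Suc k)) has_sum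
     ((2 * pi * \<i>) ^ Suc k / fact k * gauss_sum q chi *
       (\<Sum>\<^sub>\<infinity>n\<in>{1..}. of_nat n ^ k * cnj (chi (int n)) * of_real (exp (- (2 * pi * y * real n)))))) UNIV"
proof -
  have dir: "dirichlet_character q chi" using prim by (simp add: primitive_character_def)
  hence q0: "q > 0" and per: "\<And>n. chi (n + int q) = chi n" by (auto simp: dirichlet_character_def)
  have k0: "k > 0" using k by (cases k) auto
  define A where "A = (2 * pi * \<i>) ^ Suc k / fact k"
  define g where "g r = chi r * inverse (w r ^ Suc k)" for r
  define z where "z h = of_int h / of_nat q + \<i> * of_real y" for h :: int
  define e where "e h n = additive_character q (h * int n) * of_real (exp (- (2 * pi * y * real n)))" for h n
  have e: "exp (2 * pi * \<i> * z h) ^ n = e h n" for h n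
  proof -
    have "exp (2 * pi * \<i> * z h) ^ n = exp (of_nat n * (2 * pi * \<i> * z h))"
      by (simp add: exp_of_nat_mult)
    also have "of_nat n * (2 * pi * \<i> * z h) = 2 * pi * \<i> * of_int (h * int n) / of_nat q
        + of_real (- (2 * pi * y * real n))"
      by (simp add: z_def algebra_simps)
    finally show ?thesis unfolding e_def additive_character_def exp_add exp_of_real .
  qed
  have summ_e: "summable (\<lambda>n. of_nat n ^ k * e h n)" for h
    using summable_pow_mult_geometric[of "exp (2 * pi * \<i> * z h)" k] y unfolding e
    by (simp add: z_def)
  have summ_g: "g summable_on UNIV"
  proof (rule summable_on_dominated)
    show "(\<lambda>r. inverse (w r ^ Suc k)) summable_on UNIV"
    \<comment> \<open>The imaginary part y of \<open>w r\<close> pays for the 1, the real part r/q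
      for the modulus of r.\<close>
    proof (rule summable_on_int_inverse_power[where C = "1 / y + real q"])
      fix r :: int
      have "Im (w r) = y" "Re (w r) = of_int r / real q" by (simp_all add: w_def)
      hence "y \<le> norm (w r)" "\<bar>of_int r / real q\<bar> \<le> norm (w r)"
        using abs_Im_le_cmod[of "w r"] abs_Re_le_cmod[of "w r"] by auto
      hence "1 \<le> 1 / y * norm (w r)" "\<bar>of_int r\<bar> \<le> real q * norm (w r)"
        using y q0 by (auto simp: field_simps abs_divide)
      thus "1 + \<bar>real_of_int r\<bar> \<le> (1 / y + real q) * norm (w r)"
        by (simp add: ring_distribs)
    qed (use k0 in simp)
    show "norm (g r) \<le> norm (inverse (w r ^ Suc k))" for r
      unfolding g_def norm_mult using dirichlet_character_norm_le[OF dir]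
      by (intro mult_left_le_one_le) auto
  qed
  have "((\<lambda>j. \<Sum>b\<in>{0..<int q}. g (b + int q * j)) has_sum
      (\<Sum>b\<in>{0..<int q}. chi b * (A * (\<Sum>n. of_nat n ^ k * e b n)))) UNIV"
  proof (rule has_sum_finite_sum)
    fix b
    have "g (b + int q * j) = chi b * inverse ((z b + of_int j) ^ Suc k)" for j
      using q0 by (simp add: g_def w_def z_def periodic_add_mult[of chi q, OF per] add_divide_distrib add_ac)
    moreover have "((\<lambda>j::int. inverse ((z b + of_int j) ^ Suc k)) has_sum
        A * (\<Sum>n. of_nat n ^ k * e b n)) UNIV"
      using lipschitz_formula[OF _ k, of "z b"] y unfolding e A_def by (simp add: z_def)
    ultimately show "((\<lambda>j. g (b + int q * j)) has_sum chi b * (A * (\<Sum>n. of_nat n ^ k * e b n))) UNIV"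
      by (simp add: has_sum_cmult_right)
  qed
  moreover have "(\<Sum>b\<in>{0..<int q}. chi b * (A * (\<Sum>n. of_nat n ^ k * e b n))) =
      A * (\<Sum>n. \<Sum>b\<in>{0..<int q}. chi b * (of_nat n ^ k * e b n))"
  proof -
    have "(\<Sum>b\<in>{0..<int q}. chi b * (A * (\<Sum>n. of_nat n ^ k * e b n))) =
        A * (\<Sum>b\<in>{0..<int q}. chi b * (\<Sum>n. of_nat n ^ k * e b n))"
      by (simp add: sum_distrib_left mult_ac)
    also have "(\<Sum>b\<in>{0..<int q}. chi b * (\<Sum>n. of_nat n ^ k * e b n)) =
        (\<Sum>b\<in>{0..<int q}. \<Sum>n. chi b * (of_nat n ^ k * e b n))"
      by (intro sum.cong refl suminf_mult[symmetric] summ_e)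
    also have "\<dots> = (\<Sum>n. \<Sum>b\<in>{0..<int q}. chi b * (of_nat n ^ k * e b n))"
      by (intro suminf_sum[symmetric] summable_mult summ_e)
    finally show ?thesis .
  qed
  moreover define T where "T n = of_nat n ^ k * cnj (chi (int n)) * of_real (exp (- (2 * pi * y * real n)))" for n
  have "(\<Sum>b\<in>{0..<int q}. chi b * (of_nat n ^ k * e b n)) = gauss_sum q chi * T n" for n
  proof -
    have "(\<Sum>b\<in>{0..<int q}. chi b * (of_nat n ^ k * e b n)) =
       of_nat n ^ k * of_real (exp (- (2 * pi * y * real n))) * twisted_gauss_sum q chi (int n)"
      by (simp add: twisted_gauss_sum_def e_def sum_distrib_left mult_ac)
    also have "\<dots> = gauss_sum q chi * T n"
      by (simp add: twisted_gauss_sum_primitive[OF prim] T_def mult_ac)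
    finally show ?thesis .
  qed
  moreover have "(\<Sum>n. gauss_sum q chi * T n) = gauss_sum q chi * infsum T {1..}"
  proof -
    have "summable (\<lambda>n. norm (T n))"
    proof (rule summable_comparison_test')
      show "summable (\<lambda>n. real n ^ k * exp (- (2 * pi * y)) ^ n)"
        using y by (intro summable_pow_mult_geometric) simp
      show "norm (norm (T n)) \<le> real n ^ k * exp (- (2 * pi * y)) ^ n" if "n \<ge> 0" for n
      proof -
        have "norm (T n) = norm (chi (int n)) * (real n ^ k * exp (- (2 * pi * y * real n)))"
          by (simp add: T_def norm_mult norm_power)
        also have "\<dots> \<le> real n ^ k * exp (- (2 * pi * y * real n))"
          using dirichlet_character_norm_le[OF dir] by (intro mult_left_le_one_le) auto
        also have "exp (- (2 * pi * y * real n)) = exp (- (2 * pi * y)) ^ n"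
          by (simp add: exp_of_nat_mult[symmetric] mult_ac)
        finally show ?thesis by simp
      qed
    qed
    hence hs: "(T has_sum suminf T) UNIV" and s: "summable T"
      by (auto intro: norm_summable_imp_has_sum summable_norm_cancel summable_sums)
    \<comment> \<open>As k > 0 the term n = 0 vanishes, so the power series and the sum over n \<ge>
      1 agree.\<close>
    have "(T has_sum suminf T) UNIV \<longleftrightarrow> (T has_sum suminf T) {1..}"
      using k0 by (intro has_sum_cong_neutral) (auto simp: T_def not_le)
    hence "infsum T {1..} = suminf T" using hs infsumI by blast
    thus ?thesis using s by (simp add: suminf_mult)
  qed
  ultimately have "((\<lambda>j. \<Sum>b\<in>{0..<int q}. g (b + int q * j)) has_sum
      A * (gauss_sum q chi * infsum T {1..})) UNIV" by simp
  with has_sum_residue_blocks[OF q0 summ_g] have "infsum g UNIV = A * (gauss_sum q chi * infsum T {1..})"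
    by (rule has_sum_unique)
  moreover have "(g has_sum infsum g UNIV) UNIV" using summ_g by simp
  ultimately show ?thesis unfolding g_def T_def A_def by (simp only: mult.assoc)
qed

section \<open>Exchanging the two summations over the lattice\<close>

context
  fixes p q :: nat and y :: real and K :: nat and w :: "int \<Rightarrow> int \<Rightarrow> complex"
  assumes p: "p > 0" and q: "q > 0" and y: "y > 0" and K: "K \<ge> 2"
  defines "w \<equiv> (\<lambda>r m. of_int r / of_nat p + \<i> * of_real (of_int m * y))"
begin

lemma lattice_point_norm_ge:
  "\<bar>real_of_int r\<bar> \<le> real p * norm (w r m)" "\<bar>real_of_int m\<bar> * y \<le> norm (w r m)"
proof -
  have "Im (w r m) = of_int m * y" "Re (w r m) = of_int r / real p" by (simp_all add: w_def)
  hence "\<bar>of_int m * y\<bar> \<le> norm (w r m)" "\<bar>of_int r / real p\<bar> \<le> norm (w r m)"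
    using abs_Im_le_cmod[of "w r m"] abs_Re_le_cmod[of "w r m"] by auto
  thus "\<bar>real_of_int r\<bar> \<le> real p * norm (w r m)" "\<bar>real_of_int m\<bar> * y \<le> norm (w r m)"
    using p y by (auto simp: field_simps abs_divide abs_mult)
qed

lemma lattice_point_norm_ge_1:
  assumes "r \<noteq> 0" shows "1 \<le> real p * norm (w r m)"
proof -
  have "1 \<le> \<bar>real_of_int r\<bar>" using assms by linarith
  thus ?thesis using lattice_point_norm_ge(1)[of r m] by linarith
qed

lemma summable_on_lattice_column:
  assumes "\<And>r. norm (c r) \<le> 1" and "c 0 = 0"
  shows "(\<lambda>r. c r * inverse (w r m ^ K)) summable_on UNIV"
proof (rule summable_on_dominated)
  \<comment> \<open>The value 1 at r = 0 is harmless because \<open>c 0 = 0\<close>;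
    \<open>w 0 0 = 0\<close> itself would violate the lower bound demanded below.\<close>
  define v where "v r = (if r = 0 then 1 else w r m)" for r
  show "(\<lambda>r. inverse (v r ^ K)) summable_on UNIV"
  proof (rule summable_on_int_inverse_power[where C = "2 * real p"])
    fix r :: int
    show "1 + \<bar>real_of_int r\<bar> \<le> 2 * real p * norm (v r)"
    proof (cases "r = 0")
      case False
      thus ?thesis using lattice_point_norm_ge(1)[of r m] lattice_point_norm_ge_1[of r m]
        by (simp add: v_def)
    qed (use p in \<open>simp add: v_def\<close>)
  qed fact
  show "norm (c r * inverse (w r m ^ K)) \<le> norm (inverse (v r ^ K))" for r
  proof (cases "r = 0")
    case False
    thus ?thesis using assms(1)[of r] by (simp add: v_def norm_mult mult_left_le_one_le)
  qed (simp add: assms)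
qed

lemma summable_on_lattice_row:
  assumes "\<And>m. norm (e m) \<le> 1" and "r \<noteq> 0"
  shows "(\<lambda>m. e m * inverse (w r m ^ K)) summable_on UNIV"
proof (rule summable_on_dominated)
  show "(\<lambda>m. inverse (w r m ^ K)) summable_on UNIV"
  proof (rule summable_on_int_inverse_power[where C = "real p + 1 / y"])
    fix m :: int
    have "\<bar>real_of_int m\<bar> \<le> 1 / y * norm (w r m)"
      using lattice_point_norm_ge(2)[of m r] y by (simp add: field_simps)
    thus "1 + \<bar>real_of_int m\<bar> \<le> (real p + 1 / y) * norm (w r m)"
      using lattice_point_norm_ge_1[OF assms(2), of m] unfolding distrib_right by linarith
  qed fact
  show "norm (e m * inverse (w r m ^ K)) \<le> norm (inverse (w r m ^ K))" for m
    using assms(1)[of m] by (simp add: norm_mult mult_left_le_one_le)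
qed

text \<open>A shift of bounded length changes an inverse K-th power by the order of the inverse
  distance to the power K + 1, hence at least 3. Splitting the cube evenly between r and j leaves
  exponent 3/2 for each, enough for summability over all pairs.\<close>

lemma lattice_difference_bound:
  obtains C where "C \<ge> 0" and
    "\<And>r j b. \<lbrakk>r \<noteq> 0; 0 \<le> b; b < int q\<rbrakk> \<Longrightarrow>
       norm (inverse (w r (b + int q * j) ^ K) - inverse (w r (int q * j) ^ K)) \<le>
         C * ((1 + \<bar>real_of_int r\<bar>) powr (-3/2) * (1 + \<bar>real_of_int j\<bar>) powr (-3/2))"
proof -
  \<comment> \<open>\<open>M\<close> compares neighbours: \<open>w1\<close> and \<open>w2\<close>
    differ by at most q y, and the modulus of \<open>w1\<close> is at least 1/p, so that of
    \<open>w2\<close> is at most 1 + p q y times that of \<open>w1\<close>.\<close>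
  define M where "M = 1 + real p * real q * y"
  define C1 where "C1 = real p + 1 / y"
  define C2 where "C2 = real K * M ^ K * real q * y * real p ^ (K - 2)"
  define C where "C = C2 * (2 * real p) powr (3/2) * C1 powr (3/2)"
  have M: "M \<ge> 1" using y by (simp add: M_def)
  have C1: "C1 > 0" using p y by (simp add: C1_def add_pos_pos)
  have C2: "C2 \<ge> 0" using M y by (simp add: C2_def)
  show ?thesis
  proof (rule that[of C])
    show "C \<ge> 0" using C2 by (simp add: C_def)
    fix r j b :: int assume r: "r \<noteq> 0" and b: "0 \<le> b" "b < int q"
    define w1 w2 where "w1 = w r (b + int q * j)" and "w2 = w r (int q * j)"
    define u v where "u = inverse w1" and "v = inverse w2"
    have w1: "1 \<le> real p * norm w1" and w2: "1 \<le> real p * norm w2"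
      unfolding w1_def w2_def by (rule lattice_point_norm_ge_1[OF r])+
    have nz: "w1 \<noteq> 0" "w2 \<noteq> 0" using w1 w2 by auto
    have "w1 - w2 = \<i> * of_real (of_int b * y)"
      by (simp add: w1_def w2_def w_def algebra_simps)
    hence "norm (w1 - w2) = of_int b * y" using b y by (simp add: norm_mult)
    hence diff: "norm (w1 - w2) \<le> real q * y" using b y by (simp add: mult_right_mono)
    have "norm w2 \<le> norm w1 + norm (w1 - w2)" by (metis norm_minus_commute norm_triangle_sub)
    also have "\<dots> \<le> norm w1 + real q * y * (real p * norm w1)"
    proof -
      have "real q * y * 1 \<le> real q * y * (real p * norm w1)"
        using w1 y by (intro mult_left_mono) auto
      thus ?thesis using diff by simp
    qed
    also have "\<dots> = M * norm w1" by (simp add: M_def algebra_simps)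
    finally have w21: "norm w2 \<le> M * norm w1" .
    \<comment> \<open>A common bound for \<open>u\<close> and \<open>v\<close>: after division by
      \<open>R\<close> both lie in the unit disc, where \<open>norm_power_diff\<close> bounds a
      difference of K-th powers by K times the difference.\<close>
    define R where "R = M * norm v"
    have v0: "norm v > 0" using nz by (simp add: v_def)
    have R0: "R > 0" using M v0 by (simp add: R_def)
    have uR: "norm u \<le> R"
      using w21 nz by (simp add: R_def u_def v_def norm_divide field_simps)
    have vR: "norm v \<le> R" using M v0 by (simp add: R_def)
    have uv: "norm (u - v) \<le> real q * y * R * norm v"
    proof -
      have "u - v = - ((w1 - w2) * u * v)" using nz by (simp add: u_def v_def field_simps)
      hence "norm (u - v) = norm (w1 - w2) * norm u * norm v" by (simp add: norm_mult)
      also have "\<dots> \<le> (real q * y) * R * norm v"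
        using diff uR y R0 by (intro mult_mono) auto
      finally show ?thesis .
    qed
    have "norm (u ^ K - v ^ K) = R ^ K * norm ((u / of_real R) ^ K - (v / of_real R) ^ K)"
    proof -
      have "(u / of_real R) ^ K - (v / of_real R) ^ K = (u ^ K - v ^ K) / of_real (R ^ K)"
        by (simp add: power_divide diff_divide_distrib)
      thus ?thesis using R0 by (simp add: norm_divide norm_power)
    qed
    also have "\<dots> \<le> R ^ K * (real K * norm (u / of_real R - v / of_real R))"
      using uR vR R0 by (intro mult_left_mono norm_power_diff) (auto simp: norm_divide)
    also have "norm (u / of_real R - v / of_real R) = norm (u - v) / R"
      using R0 by (simp add: diff_divide_distrib[symmetric] norm_divide)
    also have "R ^ K * (real K * (norm (u - v) / R)) \<le>
        R ^ K * (real K * ((real q * y * R * norm v) / R))"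
      using uv R0 by (intro mult_left_mono divide_right_mono) auto
    \<comment> \<open>Of the K + 1 powers of \<open>norm v\<close>, three are kept; the other K - 2
      are bounded through \<open>norm v \<le> p\<close>.\<close>
    also have "\<dots> = real K * M ^ K * real q * y * (norm v ^ (K - 2) * norm v ^ 3)"
    proof -
      have "norm v ^ (K - 2) * norm v ^ 3 = norm v ^ K * norm v"
      proof -
        have "K - 2 + 3 = Suc K" using K by simp
        thus ?thesis by (simp only: power_add[symmetric] power_Suc2)
      qed
      thus ?thesis using R0 M by (simp add: R_def power_mult_distrib mult_ac)
    qed
    also have "\<dots> \<le> real K * M ^ K * real q * y * (real p ^ (K - 2) * norm v ^ 3)"
    proof -
      have "norm v \<le> real p" using w2 nz by (simp add: v_def norm_divide field_simps)
      thus ?thesis using M y by (intro mult_left_mono mult_right_mono power_mono) auto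
    qed
    also have "\<dots> = C2 * norm v ^ 3" by (simp add: C2_def mult_ac)
    finally have main: "norm (u ^ K - v ^ K) \<le> C2 * norm v ^ 3" .
    have vr: "norm v \<le> 2 * real p / (1 + \<bar>real_of_int r\<bar>)"
    proof -
      have "1 + \<bar>real_of_int r\<bar> \<le> 2 * real p * norm w2"
        using w2 lattice_point_norm_ge(1)[of r "int q * j"] by (simp add: w2_def)
      thus ?thesis using nz by (simp add: v_def norm_divide field_simps)
    qed
    have vj: "norm v \<le> C1 / (1 + \<bar>real_of_int j\<bar>)"
    proof -
      have "\<bar>real_of_int j\<bar> * y \<le> \<bar>real_of_int (int q * j)\<bar> * y"
        using q y by (intro mult_right_mono) (auto simp: abs_mult mult_le_cancel_right1)
      also have "\<dots> \<le> norm w2" unfolding w2_def by (rule lattice_point_norm_ge(2))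
      finally have "\<bar>real_of_int j\<bar> \<le> 1 / y * norm w2" using y by (simp add: field_simps)
      hence "1 + \<bar>real_of_int j\<bar> \<le> C1 * norm w2"
        unfolding C1_def distrib_right using w2 by linarith
      thus ?thesis using nz by (simp add: v_def norm_divide field_simps)
    qed
    \<comment> \<open>Each half of the cube uses one of the bounds \<open>vr\<close> and
      \<open>vj\<close>.\<close>
    have "norm v ^ 3 = norm v powr (3/2) * norm v powr (3/2)"
      using v0 by (simp add: powr_add[symmetric])
    also have "\<dots> \<le> (2 * real p / (1 + \<bar>real_of_int r\<bar>)) powr (3/2) *
        (C1 / (1 + \<bar>real_of_int j\<bar>)) powr (3/2)"
      using vr vj by (intro mult_mono powr_mono2) auto
    also have "\<dots> = (2 * real p) powr (3/2) * C1 powr (3/2) *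
        ((1 + \<bar>real_of_int r\<bar>) powr (-3/2) * (1 + \<bar>real_of_int j\<bar>) powr (-3/2))"
      using C1 by (simp add: powr_divide powr_minus field_simps)
    finally have "C2 * norm v ^ 3 \<le> C * ((1 + \<bar>real_of_int r\<bar>) powr (-3/2) * (1 + \<bar>real_of_int j\<bar>) powr (-3/2))"
      using C2 unfolding C_def by (simp add: mult.assoc mult_left_mono)
    with main show "norm (inverse (w r (b + int q * j) ^ K) - inverse (w r (int q * j) ^ K)) \<le>
         C * ((1 + \<bar>real_of_int r\<bar>) powr (-3/2) * (1 + \<bar>real_of_int j\<bar>) powr (-3/2))"
      by (simp add: u_def v_def w1_def w2_def power_inverse)
  qed
qed

text \<open>The double series need not converge absolutely when \<open>K = 2\<close>. Grouping \<open>m\<close> into blocks of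
  length \<open>q\<close>, over which \<open>e\<close> sums to zero, gains one power of the distance to the origin
  and makes the grouped series absolutely convergent.\<close>

lemma lattice_sum_swap:
  assumes c: "\<And>r. norm (c r) \<le> 1" "c 0 = 0"
    and e: "\<And>m. norm (e m) \<le> 1" "\<And>m. e (m + int q) = e m" "(\<Sum>b\<in>{0..<int q}. e b) = 0"
    and outer: "(\<lambda>m. e m * (\<Sum>\<^sub>\<infinity>r. c r * inverse (w r m ^ K))) summable_on UNIV"
  shows "(\<Sum>\<^sub>\<infinity>m. e m * (\<Sum>\<^sub>\<infinity>r. c r * inverse (w r m ^ K))) =
         (\<Sum>\<^sub>\<infinity>r. c r * (\<Sum>\<^sub>\<infinity>m. e m * inverse (w r m ^ K)))"
proof -
  define f where "f r m = inverse (w r m ^ K)" for r m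
  define D where "D r j = c r * (\<Sum>b\<in>{0..<int q}. e b * f r (b + int q * j))" for r j
  obtain C where C: "C \<ge> 0" and bound: "\<And>r j b. \<lbrakk>r \<noteq> 0; 0 \<le> b; b < int q\<rbrakk> \<Longrightarrow>
       norm (f r (b + int q * j) - f r (int q * j)) \<le>
         C * ((1 + \<bar>real_of_int r\<bar>) powr (-3/2) * (1 + \<bar>real_of_int j\<bar>) powr (-3/2))"
    unfolding f_def by (rule lattice_difference_bound) blast
  have e_per: "e (b + int q * j) = e b" for b j
    by (rule periodic_add_mult[of e q]) (rule e(2))
  have summ: "(\<lambda>(r, j). D r j) summable_on UNIV \<times> UNIV"
  proof (rule abs_summable_summable, rule Infinite_Sum.abs_summable_on_comparison_test')
    show "(\<lambda>x. real q * C * (case x of (r, j) \<Rightarrow>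
        (1 + \<bar>real_of_int r\<bar>) powr (-3/2) * (1 + \<bar>real_of_int j\<bar>) powr (-3/2))) summable_on UNIV \<times> UNIV"
      using summable_on_int_powr[of "3/2"]
      by (intro summable_on_cmult_right summable_on_Times_nonneg) auto
    fix x :: "int \<times> int"
    obtain r j where x: "x = (r, j)" by force
    define B where "B = (1 + \<bar>real_of_int r\<bar>) powr (-3/2) * (1 + \<bar>real_of_int j\<bar>) powr (-3/2)"
    have "norm (D r j) \<le> real q * C * B"
    proof (cases "r = 0")
      case True
      thus ?thesis using C c by (simp add: D_def B_def)
    next
      case False
      \<comment> \<open>Subtracting the value at the start of the block is free, since
        \<open>e\<close> sums to 0 over a period.\<close>
      have "D r j = c r * (\<Sum>b\<in>{0..<int q}. e b * (f r (b + int q * j) - f r (int q * j)))"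
        using e(3) by (simp add: D_def right_diff_distrib sum_subtractf sum_distrib_right[symmetric])
      hence "norm (D r j) = norm (c r) * norm (\<Sum>b\<in>{0..<int q}. e b * (f r (b + int q * j) - f r (int q * j)))"
        by (simp add: norm_mult)
      also have "\<dots> \<le> norm (\<Sum>b\<in>{0..<int q}. e b * (f r (b + int q * j) - f r (int q * j)))"
        using c(1) by (intro mult_left_le_one_le) auto
      also have "\<dots> \<le> (\<Sum>b\<in>{0..<int q}. C * B)"
      proof (rule sum_norm_le)
        fix b assume b: "b \<in> {0..<int q}"
        have "norm (e b * (f r (b + int q * j) - f r (int q * j))) \<le> norm (f r (b + int q * j) - f r (int q * j))"
          unfolding norm_mult using e(1) by (intro mult_left_le_one_le) auto
        also have "\<dots> \<le> C * B" unfolding B_def using False b by (intro bound) auto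
        finally show "norm (e b * (f r (b + int q * j) - f r (int q * j))) \<le> C * B" .
      qed
      finally show ?thesis by simp
    qed
    thus "norm (case x of (r, j) \<Rightarrow> D r j) \<le> real q * C * (case x of (r, j) \<Rightarrow>
        (1 + \<bar>real_of_int r\<bar>) powr (-3/2) * (1 + \<bar>real_of_int j\<bar>) powr (-3/2))"
      by (simp add: x B_def)
  qed
  \<comment> \<open>Summability of the single columns does not give that of the sum over m;
    \<open>outer\<close> provides it, and the application obtains it from the Lambert
    series.\<close>
  have "(\<Sum>\<^sub>\<infinity>m. e m * (\<Sum>\<^sub>\<infinity>r. c r * f r m)) = (\<Sum>\<^sub>\<infinity>j. \<Sum>\<^sub>\<infinity>r. D r j)"
  proof -
    have "(\<Sum>\<^sub>\<infinity>r. D r j) = (\<Sum>b\<in>{0..<int q}. e (b + int q * j) * (\<Sum>\<^sub>\<infinity>r. c r * f r (b + int q * j)))" for j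
    proof -
      have "((\<lambda>r. \<Sum>b\<in>{0..<int q}. e b * (c r * f r (b + int q * j))) has_sum
          (\<Sum>b\<in>{0..<int q}. e b * (\<Sum>\<^sub>\<infinity>r. c r * f r (b + int q * j)))) UNIV"
        unfolding f_def
        by (intro has_sum_finite_sum has_sum_cmult_right has_sum_infsum summable_on_lattice_column c)
      moreover have "(\<Sum>b\<in>{0..<int q}. e b * (c r * f r (b + int q * j))) = D r j" for r
        by (simp add: D_def sum_distrib_left mult_ac)
      ultimately show ?thesis by (simp add: infsumI e_per)
    qed
    thus ?thesis
      using has_sum_residue_blocks[OF q outer] by (simp add: infsumI f_def)
  qed
  also have "\<dots> = (\<Sum>\<^sub>\<infinity>r. \<Sum>\<^sub>\<infinity>j. D r j)"
    using infsum_swap_banach[of D UNIV UNIV] summ by simp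
  also have "(\<lambda>r. \<Sum>\<^sub>\<infinity>j. D r j) = (\<lambda>r. c r * (\<Sum>\<^sub>\<infinity>m. e m * f r m))"
  proof
    fix r
    show "(\<Sum>\<^sub>\<infinity>j. D r j) = c r * (\<Sum>\<^sub>\<infinity>m. e m * f r m)"
    proof (cases "r = 0")
      case True
      thus ?thesis using c by (simp add: D_def)
    next
      case False
      \<comment> \<open>For fixed r \<noteq> 0 the row converges absolutely on its own, so its
        blocks can be dissolved after the exchange.\<close>
      have "((\<lambda>j. \<Sum>b\<in>{0..<int q}. e (b + int q * j) * f r (b + int q * j)) has_sum
          (\<Sum>\<^sub>\<infinity>m. e m * f r m)) UNIV"
        using has_sum_residue_blocks[OF q summable_on_lattice_row[OF e(1) False]] by (simp add: f_def)
      hence "(D r has_sum c r * (\<Sum>\<^sub>\<infinity>m. e m * f r m)) UNIV"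
        unfolding D_def e_per by (rule has_sum_cmult_right)
      thus ?thesis by (rule infsumI)
    qed
  qed
  finally show ?thesis by (simp add: f_def)
qed

end

section \<open>The transformation law of the Lambert series\<close>

lemma has_sum_even_int:
  fixes h :: "int \<Rightarrow> complex"
  assumes "((\<lambda>m::nat. h (int m)) has_sum s) {1..}" and "h 0 = 0" and "\<And>m. h (-m) = h m"
  shows "(h has_sum (2 * s)) UNIV"
proof -
  have "((\<lambda>m::nat. h (int m)) has_sum s) {1..} \<longleftrightarrow> (h has_sum s) {1..}"
    by (rule has_sum_reindex_bij_witness[of _ nat int]) auto
  moreover have "((\<lambda>m::nat. h (int m)) has_sum s) {1..} \<longleftrightarrow> (h has_sum s) {..-1}"
    by (rule has_sum_reindex_bij_witness[of _ "\<lambda>m. nat (-m)" "\<lambda>m. - int m"]) (auto simp: assms(3))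
  ultimately have "(h has_sum (s + s)) ({1..} \<union> {..-1})"
    using assms(1) by (intro has_sum_Un_disjoint) auto
  moreover have "(h has_sum (s + s)) ({1..} \<union> {..-1}) \<longleftrightarrow> (h has_sum (s + s)) UNIV"
  proof (rule has_sum_cong_neutral)
    fix m assume "m \<in> UNIV - ({1..} \<union> {..- 1 :: int})"
    hence "m = 0" by auto
    thus "h m = 0" by (simp add: assms(2))
  qed auto
  ultimately show ?thesis by simp
qed

lemma dirichlet_character_minus:
  assumes "dirichlet_character q chi" shows "chi (- n) = chi (-1) * chi n"
proof -
  have "chi (-1 * n) = chi (-1) * chi n" using assms unfolding dirichlet_character_def by blast
  thus ?thesis by simp
qed

text \<open>Column m > 0 is the character Lipschitz formula with y replaced by m y, and column 0 is
  erased by \<open>psi 0 = 0\<close>. Passing to -m multiplies the column by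
  \<open>chi (-1)\<close>, as k + 1 is even, and \<open>psi m\<close> by \<open>psi (-1)\<close>;
  \<open>parity\<close> cancels the two, whence the factor 2.\<close>

lemma lattice_sum_eq_double_lambert:
  assumes chi: "primitive_character p chi" and p: "p \<noteq> 1"
    and psi: "dirichlet_character q psi" and q: "q \<noteq> 1"
    and parity: "chi (-1) * psi (-1) = 1" and y: "y > 0" and k: "odd k"
  defines "w \<equiv> (\<lambda>r m. of_int r / of_nat p + \<i> * of_real (of_int m * y))"
  shows "((\<lambda>m::int. psi m * (\<Sum>\<^sub>\<infinity>r::int. chi r * inverse (w r m ^ Suc k))) has_sum
     2 * ((2 * pi * \<i>) ^ Suc k / fact k * gauss_sum p chi *
       infsum (double_lambert k (\<lambda>n. cnj (chi n)) psi (2 * pi * y)) ({1..} \<times> {1..}))) UNIV"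
proof (rule has_sum_even_int)
  define A where "A = (2 * pi * \<i>) ^ Suc k / fact k * gauss_sum p chi"
  define L where "L = double_lambert k (\<lambda>n. cnj (chi n)) psi (2 * pi * y)"
  define S where "S m = (\<Sum>\<^sub>\<infinity>r::int. chi r * inverse (w r m ^ Suc k))" for m
  have dchi: "dirichlet_character p chi" using chi by (simp add: primitive_character_def)
  show "psi 0 * (\<Sum>\<^sub>\<infinity>r::int. chi r * inverse (w r 0 ^ Suc k)) = 0"
    using dirichlet_character_0[OF psi q] by simp
  have "S (-m) = chi (-1) * S m" for m
  proof -
    have "S (-m) = (\<Sum>\<^sub>\<infinity>r::int. chi (-1) * (chi r * inverse (w r m ^ Suc k)))"
      unfolding S_def
    proof (rule infsum_reindex_bij_witness[of _ uminus uminus])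
      fix r
      have "w r (-m) = - w (-r) m" by (simp add: w_def)
      hence "w r (-m) ^ Suc k = w (-r) m ^ Suc k" using k by (simp del: power_Suc)
      thus "chi (-1) * (chi (- r) * inverse (w (- r) m ^ Suc k)) = chi r * inverse (w r (-m) ^ Suc k)"
        using dirichlet_character_minus[OF dchi, of "-r"] by (simp only: mult_ac minus_minus)
    qed auto
    thus ?thesis by (simp add: S_def infsum_cmult_right')
  qed
  thus "psi (-m) * (\<Sum>\<^sub>\<infinity>r::int. chi r * inverse (w r (-m) ^ Suc k)) =
      psi m * (\<Sum>\<^sub>\<infinity>r::int. chi r * inverse (w r m ^ Suc k))" for m
    using parity dirichlet_character_minus[OF psi, of m] unfolding S_def
    by (simp add: mult_ac)
  have "L summable_on {1..} \<times> {1..}"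
    unfolding L_def using dirichlet_character_norm_le[OF dchi] dirichlet_character_norm_le[OF psi] y
    by (intro double_lambert_summable) auto
  hence hs: "(L has_sum infsum L ({1..} \<times> {1..})) ({1..} \<times> {1..})"
    and ss: "(\<lambda>(m, n). L (m, n)) summable_on {1..} \<times> {1..}" by simp_all
  have "((\<lambda>m. \<Sum>\<^sub>\<infinity>n\<in>{1..}. L (m, n)) has_sum infsum L ({1..} \<times> {1..})) {1..}"
    using hs by (rule has_sum_SigmaD) (rule has_sum_infsum, rule summable_on_SigmaD1[OF ss])
  hence "((\<lambda>m. A * (\<Sum>\<^sub>\<infinity>n\<in>{1..}. L (m, n))) has_sum A * infsum L ({1..} \<times> {1..})) {1..}"
    by (rule has_sum_cmult_right)
  moreover have "psi (int m) * S (int m) = A * (\<Sum>\<^sub>\<infinity>n\<in>{1..}. L (m, n))" if "m \<in> {1..}" for m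
  proof -
    have "real m * y > 0" using that y by simp
    from infsumI[OF lipschitz_formula_character[OF chi this k]]
    have "S (int m) = A * (\<Sum>\<^sub>\<infinity>n\<in>{1..}. of_nat n ^ k * cnj (chi (int n)) *
        of_real (exp (- (2 * pi * (real m * y) * real n))))"
      by (simp add: S_def w_def A_def)
    also have "psi (int m) * \<dots> = A * (\<Sum>\<^sub>\<infinity>n\<in>{1..}. psi (int m) * (of_nat n ^ k * cnj (chi (int n)) *
        of_real (exp (- (2 * pi * (real m * y) * real n)))))"
      by (simp add: infsum_cmult_right')
    also have "\<dots> = A * (\<Sum>\<^sub>\<infinity>n\<in>{1..}. L (m, n))"
      by (simp add: L_def double_lambert_def mult_ac)
    finally show ?thesis .
  qed
  ultimately show "((\<lambda>m. psi (int m) * (\<Sum>\<^sub>\<infinity>r::int. chi r * inverse (w r (int m) ^ Suc k))) has_sum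
      (2 * pi * \<i>) ^ Suc k / fact k * gauss_sum p chi *
       infsum (double_lambert k (\<lambda>n. cnj (chi n)) psi (2 * pi * y)) ({1..} \<times> {1..})) {1..}"
    unfolding A_def[symmetric] L_def[symmetric] S_def[symmetric]
    by (subst has_sum_cong) auto
qed

text \<open>One lattice is read in two ways: r/p + i m y = i y q (m/q - i r y') with y' = 1 / (p q
  y). Summing over r first gives the Lambert series at y, summing over m first the one at y'; the
  inverse power on the right comes from the factor i y q.\<close>

lemma double_lambert_transformation:
  assumes chi1: "primitive_character p chi1" and p: "p \<noteq> 1"
    and chi2: "primitive_character q chi2" and q: "q \<noteq> 1"
    and parity: "chi1 (-1) = chi2 (-1)" "chi1 (-1) \<in> {1, -1}" and y: "y > 0" and k: "odd k"
  shows "of_nat p * infsum (double_lambert k chi1 chi2 (2 * pi * y)) ({1..} \<times> {1..}) =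
     inverse ((\<i> * of_real (y * real q)) ^ Suc k) * gauss_sum p chi1 * gauss_sum q chi2 *
       infsum (double_lambert k (\<lambda>n. cnj (chi2 n)) (\<lambda>n. cnj (chi1 n))
         (2 * pi * (1 / (real p * real q * y)))) ({1..} \<times> {1..})"
proof -
  define A where "A = (2 * pi * \<i>) ^ Suc k / fact k"
  define P where "P = {1::nat..} \<times> {1::nat..}"
  define y' where "y' = 1 / (real p * real q * y)"
  define D where "D = inverse ((\<i> * of_real (y * real q)) ^ Suc k)"
  define F where "F = infsum (double_lambert k chi1 chi2 (2 * pi * y)) P"
  define G where "G = infsum (double_lambert k (\<lambda>n. cnj (chi2 n)) (\<lambda>n. cnj (chi1 n)) (2 * pi * y')) P"
  \<comment> \<open>Conjugated beforehand, since the Lipschitz formula returns the conjugate: the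
    series in \<open>F\<close> then has \<open>chi1\<close>.\<close>
  define c where "c n = cnj (chi1 n)" for n
  define w where "w r m = of_int r / of_nat p + \<i> * of_real (of_int m * y)" for r m
  define v where "v m r = of_int m / of_nat q + \<i> * of_real (of_int r * y')" for m r
  have d1: "dirichlet_character p chi1" and d2: "dirichlet_character q chi2"
    using chi1 chi2 by (auto simp: primitive_character_def)
  have p0: "p > 0" and q0: "q > 0" using d1 d2 by (auto simp: dirichlet_character_def)
  have y': "y' > 0" using p0 q0 y by (simp add: y'_def)
  have primc: "primitive_character p c" unfolding c_def by (rule primitive_character_cnj[OF chi1])
  have dc: "dirichlet_character p c" using primc by (simp add: primitive_character_def)
  have A: "A \<noteq> 0" by (simp add: A_def)
  have cm: "c (-1) = chi1 (-1)" "chi1 (-1) * chi1 (-1) = 1"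
    using parity(2) by (auto simp: c_def)
  have par: "c (-1) * chi2 (-1) = 1" "chi2 (-1) * c (-1) = 1"
    using cm parity(1) by auto
  have cc: "(\<lambda>n. cnj (c n)) = chi1" and c_eta: "(\<lambda>n. cnj (chi1 n)) = c"
    by (simp_all add: c_def fun_eq_iff)
  have hs1: "((\<lambda>m::int. chi2 m * (\<Sum>\<^sub>\<infinity>r::int. c r * inverse (w r m ^ Suc k))) has_sum
      2 * (A * gauss_sum p c * F)) UNIV"
    using lattice_sum_eq_double_lambert[OF primc p d2 q par(1) y k]
    unfolding A_def F_def P_def w_def cc .
  have hs2: "((\<lambda>r::int. c r * (\<Sum>\<^sub>\<infinity>m::int. chi2 m * inverse (v m r ^ Suc k))) has_sum
      2 * (A * gauss_sum q chi2 * G)) UNIV"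
    using lattice_sum_eq_double_lambert[OF chi2 q dc p par(2) y' k]
    unfolding A_def G_def P_def v_def c_eta .
  have wv: "inverse (w r m ^ Suc k) = D * inverse (v m (-r) ^ Suc k)" for r m
  proof -
    have "w r m = \<i> * of_real (y * real q) * v m (-r)"
      using p0 q0 y by (simp add: w_def v_def y'_def field_simps)
    thus ?thesis unfolding D_def by (simp only: power_mult_distrib inverse_mult_distrib)
  qed
  have "2 * (A * gauss_sum p c * F) =
      (\<Sum>\<^sub>\<infinity>m. chi2 m * (\<Sum>\<^sub>\<infinity>r::int. c r * inverse (w r m ^ Suc k)))"
    using hs1 by (simp add: infsumI)
  also have "\<dots> = (\<Sum>\<^sub>\<infinity>r. c r * (\<Sum>\<^sub>\<infinity>m. chi2 m * inverse (w r m ^ Suc k)))"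
    unfolding w_def
  proof (rule lattice_sum_swap[OF p0 q0 y])
    show "chi2 (m + int q) = chi2 m" for m using d2 by (auto simp: dirichlet_character_def)
    show "2 \<le> Suc k" using k by (cases k) auto
    show "(\<lambda>m. chi2 m * (\<Sum>\<^sub>\<infinity>r. c r * inverse ((of_int r / of_nat p + \<i> * of_real (of_int m * y)) ^ Suc k)))
       summable_on UNIV"
      using has_sum_imp_summable[OF hs1] by (simp add: w_def)
  qed (use dirichlet_character_norm_le[OF dc] dirichlet_character_0[OF dc p]
      dirichlet_character_norm_le[OF d2] primitive_character_sum_eq_0[OF chi2 q] in auto)
  \<comment> \<open>The reflection r \<mapsto> -r removes the minus sign in \<open>wv\<close> and
    costs the factor \<open>c (-1)\<close>.\<close>
  also have "\<dots> = (\<Sum>\<^sub>\<infinity>r. D * c (-1) * (c r * (\<Sum>\<^sub>\<infinity>m. chi2 m * inverse (v m r ^ Suc k))))"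
  proof (rule infsum_reindex_bij_witness[of _ uminus uminus])
    fix r
    have "c r * (\<Sum>\<^sub>\<infinity>m. chi2 m * inverse (w r m ^ Suc k)) =
        c r * (\<Sum>\<^sub>\<infinity>m. D * (chi2 m * inverse (v m (-r) ^ Suc k)))"
      by (simp only: wv mult_ac)
    also have "\<dots> = D * c r * (\<Sum>\<^sub>\<infinity>m. chi2 m * inverse (v m (-r) ^ Suc k))"
      by (simp only: infsum_cmult_right' mult_ac)
    also have "\<dots> = D * (c (-1) * c (-r)) * (\<Sum>\<^sub>\<infinity>m. chi2 m * inverse (v m (-r) ^ Suc k))"
      using dirichlet_character_minus[OF dc, of "-r"] by simp
    finally show "D * c (-1) * (c (-r) * (\<Sum>\<^sub>\<infinity>m. chi2 m * inverse (v m (-r) ^ Suc k))) =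
        c r * (\<Sum>\<^sub>\<infinity>m. chi2 m * inverse (w r m ^ Suc k))"
      by (simp only: mult_ac)
  qed auto
  also have "\<dots> = D * c (-1) * (2 * (A * gauss_sum q chi2 * G))"
    using hs2 by (simp add: infsum_cmult_right' infsumI)
  finally have "A * (2 * (gauss_sum p c * F)) = A * (2 * (D * chi1 (-1) * gauss_sum q chi2 * G))"
    by (simp add: cm mult_ac)
  hence *: "gauss_sum p c * F = D * chi1 (-1) * gauss_sum q chi2 * G"
    using A by simp
  \<comment> \<open>Multiplying by \<tau>(chi1) turns \<tau>(cnj chi1) into chi1(-1) p; the sign
    then stands on both sides and cancels.\<close>
  have "chi1 (-1) * (of_nat p * F) = gauss_sum p chi1 * (gauss_sum p c * F)"
    using gauss_sum_mult_cnj[OF chi1] by (simp only: c_eta mult.assoc[symmetric])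
  also have "\<dots> = chi1 (-1) * (D * gauss_sum p chi1 * gauss_sum q chi2 * G)"
    unfolding * by (simp only: mult_ac)
  finally have "chi1 (-1) * (of_nat p * F) = chi1 (-1) * (D * gauss_sum p chi1 * gauss_sum q chi2 * G)" .
  hence "of_nat p * F = D * gauss_sum p chi1 * gauss_sum q chi2 * G"
    using parity(2) by auto
  thus ?thesis by (simp add: F_def G_def D_def P_def y'_def)
qed

subsection \<open>Integral representations\<close>

text \<open>Euler's integral under t = B exp(-v): the Jacobian has modulus t, so t^(s-1) dt becomes
  t^s dv, and B^s is moved to the other side.\<close>

lemma Gamma_integral_exp:
  assumes s: "Re s > 0" and B: "B > 0"
  shows "has_bochner_integral lborel (\<lambda>v. exp (- s * of_real v - of_real (B * exp (- v))))
           (Gamma s * of_real B powr (-s))"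
proof -
  define f where "f t = complex_of_real t powr (s - 1) / of_real (exp t)" for t
  define g where "g v = B * exp (- v)" for v
  define h where "h v = exp (- s * of_real v - of_real (B * exp (- v)))" for v
  have range: "range g = {0<..}"
  proof -
    have "t \<in> range g" if "t > 0" for t
      using that B by (intro range_eqI[of _ _ "- ln (t / B)"]) (simp add: g_def)
    thus ?thesis using B by (auto simp: g_def)
  qed
  have "f absolutely_integrable_on range g \<and> integral (range g) f = Gamma s"
    unfolding range f_def
    using absolutely_integrable_Gamma_integral'[OF s] Gamma_integral_complex'[OF s]
    by (auto intro: integral_unique)
  hence *: "(\<lambda>v. \<bar>- g v\<bar> *\<^sub>R f (g v)) absolutely_integrable_on UNIV \<and>
      integral UNIV (\<lambda>v. \<bar>- g v\<bar> *\<^sub>R f (g v)) = Gamma s"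
  proof (subst has_absolute_integral_change_of_variables_real)
    show "(g has_field_derivative - g v) (at v within UNIV)" for v
      unfolding g_def[abs_def] by (auto intro!: derivative_eq_intros)
    show "inj g" using B by (auto simp: g_def inj_on_def)
  qed auto
  have eq: "\<bar>- g v\<bar> *\<^sub>R f (g v) = of_real B powr s * h v" for v
  proof -
    have g: "g v > 0" using B by (simp add: g_def)
    have "\<bar>- g v\<bar> *\<^sub>R f (g v) = of_real (g v) * of_real (g v) powr (s - 1) / of_real (exp (g v))"
      using g by (simp add: f_def scaleR_conv_of_real)
    also have "of_real (g v) * of_real (g v) powr (s - 1) = of_real (g v) powr s"
      using g by (simp add: powr_diff)
    also have "\<dots> = of_real B powr s * of_real (exp (- v)) powr s"
      using B by (simp add: g_def powr_times_real)
    also have "of_real (exp (- v)) powr s = exp (- s * of_real v)"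
      by (simp add: powr_def Ln_of_real)
    also have "of_real B powr s * exp (- s * of_real v) / of_real (exp (g v)) = of_real B powr s * h v"
      by (simp only: h_def g_def exp_diff exp_of_real times_divide_eq_right)
    finally show ?thesis .
  qed
  have Bs: "of_real B powr s \<noteq> 0" using B by simp
  have "(\<lambda>v. of_real B powr s * h v) absolutely_integrable_on UNIV"
    and int: "integral UNIV (\<lambda>v. of_real B powr s * h v) = Gamma s"
    using * unfolding eq by auto
  hence hint: "h absolutely_integrable_on UNIV" using Bs by simp
  \<comment> \<open>The change of variables takes place on the completed measure; continuity of
    \<open>h\<close> gives Borel measurability and with it the passage to
    \<open>lborel\<close>.\<close>
  have meas: "h \<in> borel_measurable lborel"
    unfolding h_def measurable_lborel2
    by (intro borel_measurable_continuous_onI continuous_intros)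
  have "integrable lebesgue h" using hint by (simp add: set_integrable_def)
  hence intg: "integrable lborel h" using meas by (simp add: integrable_completion)
  have "integral UNIV h = integral\<^sup>L lborel h"
    using integral_lborel[OF intg] by simp
  moreover have "of_real B powr s * integral UNIV h = Gamma s" using int by simp
  moreover have "of_real B powr s * of_real B powr (-s) = 1"
    using Bs by (simp add: powr_minus)
  ultimately have "integral\<^sup>L lborel h = Gamma s * of_real B powr (-s)"
    by (metis mult.assoc mult.commute mult.right_neutral)
  with intg have "has_bochner_integral lborel h (Gamma s * of_real B powr (-s))"
    by (simp add: has_bochner_integral_iff)
  thus ?thesis by (simp only: h_def[abs_def])
qed

text \<open>The modulus of the integrand is the integrand at the real exponent Re s, so the previous
  evaluation gives the exact L1 norm.\<close>

lemma Gamma_integral_exp_norm: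
  assumes s: "Re s > 0" and B: "B > 0"
  shows "has_bochner_integral lborel (\<lambda>v. norm (exp (- s * of_real v - of_real (B * exp (- v)))))
           (Gamma (Re s) * B powr (- Re s))"
proof -
  define f where "f = (\<lambda>v. exp (- complex_of_real (Re s) * of_real v - of_real (B * exp (- v))))"
  have "has_bochner_integral lborel f (Gamma (of_real (Re s)) * of_real B powr (- of_real (Re s)))"
    unfolding f_def using assms by (intro Gamma_integral_exp) auto
  hence "has_bochner_integral lborel (\<lambda>v. Re (f v))
      (Re (Gamma (of_real (Re s)) * of_real B powr (- of_real (Re s))))"
    by (rule has_bochner_integral_Re)
  moreover have "Re (f v) = norm (exp (- s * of_real v - of_real (B * exp (- v))))" for v
    by (simp add: f_def Re_exp)
  moreover have "Gamma (of_real (Re s)) * of_real B powr (- of_real (Re s)) =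
      complex_of_real (Gamma (Re s) * B powr (- Re s))"
    using B by (simp add: Gamma_complex_of_real powr_of_real[symmetric])
  ultimately show ?thesis by (simp only: Re_complex_of_real)
qed

text \<open>The integrand \<open>t\<^sup>-\<^sup>\<nu>\<^sup>-\<^sup>1 exp (- c t - b / t)\<close> in the variable \<open>v = ln t\<close>.\<close>

definition bessel_kernel :: "complex \<Rightarrow> real \<Rightarrow> real \<Rightarrow> real \<Rightarrow> complex" where
  "bessel_kernel \<nu> c b v = exp (- \<nu> * of_real v - of_real (c * exp v) - of_real (b * exp (- v)))"

text \<open>Bounding exp(-c exp v) by N! / (c exp v)^N shifts the exponent \<nu> by N and leaves a
  Gamma integral. N is free, so the L1 norm decays faster than any power of c, which pays for the
  growth of the divisor sums.\<close>

lemma bessel_kernel_integrable: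
  assumes nu: "Re \<nu> > 0" and c: "c > 0" and b: "b > 0"
  shows "integrable lborel (bessel_kernel \<nu> c b)"
    and "(\<integral>v. norm (bessel_kernel \<nu> c b v) \<partial>lborel) \<le>
           fact N / c ^ N * (Gamma (Re \<nu> + real N) * b powr (- (Re \<nu> + real N)))"
proof -
  define s where "s = \<nu> + of_nat N"
  define g where "g v = fact N / c ^ N * norm (exp (- s * of_real v - of_real (b * exp (- v))))" for v
  have hb: "has_bochner_integral lborel g
      (fact N / c ^ N * (Gamma (Re \<nu> + real N) * b powr (- (Re \<nu> + real N))))"
    unfolding g_def using Gamma_integral_exp_norm[of s b] nu b
    by (intro has_bochner_integral_mult_right) (auto simp: s_def)
  have bound: "norm (bessel_kernel \<nu> c b v) \<le> g v" for v
  proof -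
    have "norm (bessel_kernel \<nu> c b v) = exp (- (c * exp v)) * exp (- Re \<nu> * v - b * exp (- v))"
      by (simp add: bessel_kernel_def exp_add[symmetric])
    also have "\<dots> \<le> fact N / (c * exp v) ^ N * exp (- Re \<nu> * v - b * exp (- v))"
      using c by (intro mult_right_mono exp_minus_le_power) auto
    also have "fact N / (c * exp v) ^ N = fact N / c ^ N * exp (- (real N * v))"
      by (simp add: power_mult_distrib exp_of_nat_mult[symmetric] exp_minus field_simps)
    also have "fact N / c ^ N * exp (- (real N * v)) * exp (- Re \<nu> * v - b * exp (- v)) = g v"
      by (simp add: g_def s_def exp_add[symmetric] algebra_simps)
    finally show ?thesis .
  qed
  have meas: "bessel_kernel \<nu> c b \<in> borel_measurable lborel"
    unfolding bessel_kernel_def[abs_def] measurable_lborel2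
    by (intro borel_measurable_continuous_onI continuous_intros)
  have g: "integrable lborel g" using hb by (simp add: has_bochner_integral_iff)
  show int: "integrable lborel (bessel_kernel \<nu> c b)"
    by (rule Bochner_Integration.integrable_bound[OF g meas])
       (use bound in \<open>auto intro: order.trans[OF _ abs_ge_self]\<close>)
  have "(\<integral>v. norm (bessel_kernel \<nu> c b v) \<partial>lborel) \<le> integral\<^sup>L lborel g"
    using int g bound by (intro integral_mono) auto
  thus "(\<integral>v. norm (bessel_kernel \<nu> c b v) \<partial>lborel) \<le>
      fact N / c ^ N * (Gamma (Re \<nu> + real N) * b powr (- (Re \<nu> + real N)))"
    using hb by (simp add: has_bochner_integral_iff)
qed

text \<open>For c = b = z/2 the two exponentials combine to exp(-z cosh v), and the even part of the
  kernel is the integrand of \<open>besselK\<close>. Reflection makes the integral of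
  \<open>H\<close> over each half line equal to the kernel integral over the whole line; the halves
  overlap only in the null set {0}.\<close>

lemma besselK_eq_kernel_integral:
  assumes nu: "Re \<nu> > 0" and z: "z > 0"
  shows "besselK \<nu> z = (\<integral>v. bessel_kernel \<nu> (z / 2) (z / 2) v \<partial>lborel) / 2"
proof -
  define h where "h = bessel_kernel \<nu> (z / 2) (z / 2)"
  have h: "integrable lborel h" unfolding h_def using assms by (intro bessel_kernel_integrable) auto
  have h': "integrable lborel (\<lambda>v. h (- v))"
    using lborel_integrable_real_affine[OF h, of "-1" 0] by simp
  have reflect: "(\<integral>v. f (- v) \<partial>lborel) = (\<integral>v. f v \<partial>lborel)" for f :: "real \<Rightarrow> complex"
    using lborel_integral_real_affine[of "-1" f 0] by simp
  have 1: "of_real (exp (- z * cosh t)) * cosh (\<nu> * of_real t) = (h t + h (- t)) / 2" for t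
  proof -
    have "h t = exp (- (\<nu> * of_real t)) * of_real (exp (- z * cosh t))"
      "h (- t) = exp (\<nu> * of_real t) * of_real (exp (- z * cosh t))"
      unfolding h_def bessel_kernel_def
      by (simp_all add: exp_of_real[symmetric] exp_add[symmetric] cosh_def algebra_simps add_divide_distrib)
    thus ?thesis by (simp add: cosh_def algebra_simps add_divide_distrib scaleR_conv_of_real)
  qed
  define H where "H v = h v + h (- v)" for v
  have H: "integrable lborel H" unfolding H_def using h h' by simp
  have I: "integrable lborel (\<lambda>v. indicator {0..} v *\<^sub>R H v)"
    using H by (intro integrable_mult_indicator) auto
  have J: "integrable lborel (\<lambda>v. indicator {..0} v *\<^sub>R H v)"
    using H by (intro integrable_mult_indicator) auto
  have "(\<integral>v. indicator {..0} v *\<^sub>R H v \<partial>lborel) = (\<integral>v. indicator {0..} v *\<^sub>R H v \<partial>lborel)"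
    by (subst reflect[symmetric]) (auto simp: H_def add.commute indicator_def intro!: Bochner_Integration.integral_cong)
  hence "2 * (\<integral>v. indicator {0..} v *\<^sub>R H v \<partial>lborel) =
      (\<integral>v. indicator {0..} v *\<^sub>R H v + indicator {..0} v *\<^sub>R H v \<partial>lborel)"
    using I J by simp
  also have "\<dots> = (\<integral>v. H v \<partial>lborel)"
  proof (rule integral_cong_AE)
    show "AE v in lborel. indicator {0..} v *\<^sub>R H v + indicator {..0} v *\<^sub>R H v = H v"
      using AE_lborel_singleton[of 0] by eventually_elim (auto simp: indicator_def)
  qed (use I J H in \<open>auto simp del: measurable_lborel2\<close>)
  also have "\<dots> = 2 * (\<integral>v. h v \<partial>lborel)" unfolding H_def using h h' by (simp add: reflect)
  finally have half: "(\<integral>v. indicator {0..} v *\<^sub>R H v \<partial>lborel) = (\<integral>v. h v \<partial>lborel)" by simp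
  have "set_integrable lborel {0..} H" using I by (simp add: set_integrable_def)
  from set_borel_integral_eq_integral[OF this] half
  have "integral {0..} H = (\<integral>v. h v \<partial>lborel)" by (simp add: set_lebesgue_integral_def)
  thus ?thesis unfolding besselK_def 1 H_def[symmetric] h_def[symmetric] by simp
qed

text \<open>A translation by L = ln(c/b) / 2 makes the two coefficients equal to sqrt(c b), the
  symmetric case. The factor exp(-\<nu> L) that it produces turns c^(\<nu>/2) into
  b^(\<nu>/2).\<close>

lemma besselK_scaled:
  assumes nu: "Re \<nu> > 0" and c: "c > 0" and b: "b > 0"
  shows "of_real c powr (\<nu> / 2) * besselK \<nu> (2 * sqrt (c * b)) =
     of_real b powr (\<nu> / 2) * (\<integral>v. bessel_kernel \<nu> c b v \<partial>lborel) / 2"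
proof -
  define L where "L = ln (c / b) / 2"
  define z where "z = sqrt (c * b)"
  have zL: "z * exp L = c" "z * exp (- L) = b"
  proof -
    have "exp L = sqrt (c / b)" using b c by (simp add: L_def powr_half_sqrt[symmetric] powr_def)
    hence eL: "exp L = sqrt c / sqrt b" by (simp add: real_sqrt_divide)
    have "z * exp L = sqrt c * sqrt c * (sqrt b / sqrt b)"
      "z * exp (- L) = sqrt b * sqrt b * (sqrt c / sqrt c)"
      unfolding exp_minus eL by (simp_all add: z_def real_sqrt_mult)
    thus "z * exp L = c" "z * exp (- L) = b" using b c by simp_all
  qed
  have shift: "bessel_kernel \<nu> z z (L + v) = exp (- \<nu> * of_real L) * bessel_kernel \<nu> c b v" for v
  proof -
    have "z * exp (L + v) = c * exp v" "z * exp (- (L + v)) = b * exp (- v)"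
      using zL by (simp_all add: exp_add exp_diff exp_minus field_simps)
    hence "bessel_kernel \<nu> z z (L + v) =
        exp (- \<nu> * of_real (L + v) - of_real (c * exp v) - of_real (b * exp (- v)))"
      unfolding bessel_kernel_def by (simp only:)
    also have "\<dots> = exp (- \<nu> * of_real L + (- \<nu> * of_real v - of_real (c * exp v) - of_real (b * exp (- v))))"
      by (simp add: algebra_simps)
    finally show ?thesis by (simp only: exp_add bessel_kernel_def)
  qed
  have "besselK \<nu> (2 * z) = (\<integral>v. bessel_kernel \<nu> z z v \<partial>lborel) / 2"
    using besselK_eq_kernel_integral[OF nu, of "2 * z"] b c by (simp add: z_def)
  also have "(\<integral>v. bessel_kernel \<nu> z z v \<partial>lborel) = (\<integral>v. bessel_kernel \<nu> z z (L + v) \<partial>lborel)"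
    using lborel_integral_real_affine[of 1 "bessel_kernel \<nu> z z" L] by simp
  also have "\<dots> = (\<integral>v. exp (- \<nu> * of_real L) * bessel_kernel \<nu> c b v \<partial>lborel)"
    by (simp only: shift)
  also have "(\<integral>v. exp (- \<nu> * of_real L) * bessel_kernel \<nu> c b v \<partial>lborel) =
      exp (- \<nu> * of_real L) * (\<integral>v. bessel_kernel \<nu> c b v \<partial>lborel)"
    using bessel_kernel_integrable(1)[OF assms] by simp
  finally have "of_real c powr (\<nu> / 2) * besselK \<nu> (2 * z) =
      (of_real c powr (\<nu> / 2) * exp (- \<nu> * of_real L)) * (\<integral>v. bessel_kernel \<nu> c b v \<partial>lborel) / 2"
    by simp
  also have "of_real c powr (\<nu> / 2) * exp (- \<nu> * of_real L) = of_real b powr (\<nu> / 2)"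
    using b c by (simp add: powr_def exp_add[symmetric] Ln_of_real L_def ln_div field_simps)
  finally show ?thesis by (simp add: z_def)
qed

subsection \<open>Divisor sums\<close>

text \<open>The pair (m, d) corresponds to n = m d - 1 with divisor d of \<open>Suc n\<close>; the
  shift lets the outer index range over all naturals, as \<open>sums\<close> requires.\<close>

lemma has_sum_divisors:
  fixes f :: "nat \<times> nat \<Rightarrow> 'a :: {topological_comm_monoid_add, t3_space}"
  assumes "(f has_sum S) ({1..} \<times> {1..})"
  shows "((\<lambda>n. \<Sum>d | d dvd Suc n. f (Suc n div d, d)) has_sum S) UNIV"
proof -
  have "((\<lambda>(n, d). f (Suc n div d, d)) has_sum S) (SIGMA n:UNIV. {d. d dvd Suc n}) \<longleftrightarrow>
      (f has_sum S) ({1..} \<times> {1..})"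
  proof (rule has_sum_reindex_bij_witness[of _ "\<lambda>(m, d). (m * d - 1, d)" "\<lambda>(n, d). (Suc n div d, d)"])
    fix x :: "nat \<times> nat" assume "x \<in> (SIGMA n:UNIV. {d. d dvd Suc n})"
    then obtain n d m where x: "x = (n, d)" and m: "Suc n = d * m" by (auto elim!: dvdE)
    hence "d > 0" "m > 0" by (auto intro: gr0I)
    moreover have "m * d - 1 = n" using m by (simp add: mult.commute)
    ultimately show "(case case x of (n, d) \<Rightarrow> (Suc n div d, d) of (m, d) \<Rightarrow> (m * d - 1, d)) = x"
      "(case x of (n, d) \<Rightarrow> (Suc n div d, d)) \<in> {1..} \<times> {1..}"
      by (simp_all add: x m)
  qed auto
  with assms have "((\<lambda>(n, d). f (Suc n div d, d)) has_sum S) (SIGMA n:UNIV. {d. d dvd Suc n})"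
    by simp
  thus ?thesis by (rule has_sum_SigmaD) (auto intro!: has_sum_finiteI)
qed

lemma sigma_chi_of_nat:
  assumes "k > 0"
  shows "sigma_chi (of_nat k) chi psi n =
    (\<Sum>d | d dvd n. of_nat d ^ k * chi (int d) * psi (int (n div d)))"
  using assms by (simp add: sigma_chi_def powr_nat')

lemma sigma_chi_norm_le:
  assumes k: "k > 0" and chi: "\<And>n. norm (chi n) \<le> 1" and psi: "\<And>n. norm (psi n) \<le> 1"
  shows "norm (sigma_chi (of_nat k) chi psi n) \<le> (\<Sum>d | d dvd n. real d ^ k)"
  unfolding sigma_chi_of_nat[OF k]
proof (rule sum_norm_le)
  fix d
  have "norm (of_nat d ^ k * chi (int d) * psi (int (n div d))) =
      real d ^ k * (norm (chi (int d)) * norm (psi (int (n div d))))"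
    by (simp add: norm_mult norm_power mult_ac)
  also have "\<dots> \<le> real d ^ k * 1"
    using chi psi by (intro mult_left_mono mult_le_one) auto
  finally show "norm (of_nat d ^ k * chi (int d) * psi (int (n div d))) \<le> real d ^ k" by simp
qed

lemma sum_divisors_power_le:
  assumes "n > 0" shows "(\<Sum>d | d dvd n. real d ^ k) \<le> real n ^ (k + 1)"
proof -
  have sub: "{d. d dvd n} \<subseteq> {1..n}" using assms by (auto dest: dvd_imp_le intro: Suc_leI gr0I)
  have "(\<Sum>d | d dvd n. real d ^ k) \<le> (\<Sum>d\<in>{1..n}. real d ^ k)"
    using sub by (intro sum_mono2) auto
  also have "\<dots> \<le> (\<Sum>d\<in>{1..n}. real n ^ k)" by (intro sum_mono power_mono) auto
  finally show ?thesis by simp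
qed

lemma sigma_chi_exp_sums:
  assumes k: "k > 0" and chi: "\<And>n. norm (chi n) \<le> 1" and psi: "\<And>n. norm (psi n) \<le> 1" and t: "t > 0"
  defines "f \<equiv> (\<lambda>n. sigma_chi (of_nat k) chi psi (Suc n) * of_real (exp (- (t * real (Suc n)))))"
  shows "f sums infsum (double_lambert k chi psi t) ({1..} \<times> {1..})"
    and "summable (\<lambda>n. norm (f n))"
proof -
  have "(double_lambert k chi psi t has_sum infsum (double_lambert k chi psi t) ({1..} \<times> {1..})) ({1..} \<times> {1..})"
    using double_lambert_summable[OF chi psi t] by simp
  hence "((\<lambda>n. \<Sum>d | d dvd Suc n. double_lambert k chi psi t (Suc n div d, d)) has_sum
      infsum (double_lambert k chi psi t) ({1..} \<times> {1..})) UNIV"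
    by (rule has_sum_divisors)
  moreover have "(\<Sum>d | d dvd Suc n. double_lambert k chi psi t (Suc n div d, d)) = f n" for n
    unfolding f_def sigma_chi_of_nat[OF k] sum_distrib_right
  proof (rule sum.cong[OF refl])
    fix d assume "d \<in> {d. d dvd Suc n}"
    hence "real d * real (Suc n div d) = real (Suc n)"
      by (simp flip: of_nat_mult del: of_nat_Suc)
    thus "double_lambert k chi psi t (Suc n div d, d) =
        of_nat d ^ k * chi (int d) * psi (int (Suc n div d)) * of_real (exp (- (t * real (Suc n))))"
      by (simp add: double_lambert_def mult.assoc)
  qed
  ultimately have hs: "(f has_sum infsum (double_lambert k chi psi t) ({1..} \<times> {1..})) UNIV"
    by simp
  thus "f sums infsum (double_lambert k chi psi t) ({1..} \<times> {1..})" by (rule has_sum_imp_sums)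
  have "(\<lambda>n. norm (f n)) summable_on UNIV"
    using has_sum_imp_summable[OF hs] by (simp add: summable_on_iff_abs_summable_on_complex)
  thus "summable (\<lambda>n. norm (f n))" by (rule summable_on_imp_summable)
qed

text \<open>Writing n = m d splits the majorant into m^(-\<rho>) d^(k-\<rho>), and \<rho> > k + 1 is
  what makes the sum over d converge.\<close>

lemma summable_sigma_chi_powr:
  assumes k: "k > 0" and chi: "\<And>n. norm (chi n) \<le> 1" and psi: "\<And>n. norm (psi n) \<le> 1"
    and rho: "\<rho> > real k + 1"
  shows "summable (\<lambda>n. norm (sigma_chi (of_nat k) chi psi (Suc n)) * real (Suc n) powr (-\<rho>))"
proof -
  have powr: "(\<lambda>n::nat. real n powr (-r)) summable_on {1..}" if "r > 1" for r
  proof -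
    have "summable (\<lambda>n. real n powr (-r))" using that by (simp add: summable_real_powr_iff)
    hence "(\<lambda>n::nat. real n powr (-r)) summable_on UNIV"
      by (simp add: summable_on_UNIV_nonneg_real_iff)
    thus ?thesis by (rule summable_on_subset_banach) simp
  qed
  define g where "g = (\<lambda>(m, d). real m powr (-\<rho>) * real d powr (- (\<rho> - real k)))"
  have "g summable_on {1..} \<times> {1..}"
    unfolding g_def using rho by (intro summable_on_Times_nonneg powr) auto
  hence "(g has_sum infsum g ({1..} \<times> {1..})) ({1..} \<times> {1..})" by simp
  hence "((\<lambda>n. \<Sum>d | d dvd Suc n. g (Suc n div d, d)) has_sum infsum g ({1..} \<times> {1..})) UNIV"
    by (rule has_sum_divisors)
  hence "summable (\<lambda>n. \<Sum>d | d dvd Suc n. g (Suc n div d, d))"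
    by (intro summable_on_imp_summable has_sum_imp_summable)
  thus ?thesis
  proof (rule summable_comparison_test'[where N = 0])
    fix n
    have "norm (sigma_chi (of_nat k) chi psi (Suc n)) * real (Suc n) powr (-\<rho>) \<le>
        (\<Sum>d | d dvd Suc n. real d ^ k) * real (Suc n) powr (-\<rho>)"
      using sigma_chi_norm_le[OF k chi psi] by (intro mult_right_mono) auto
    also have "\<dots> = (\<Sum>d | d dvd Suc n. g (Suc n div d, d))"
      unfolding sum_distrib_right
    proof (rule sum.cong[OF refl])
      fix d assume "d \<in> {d. d dvd Suc n}"
      then obtain m where m: "Suc n = d * m" by (auto elim!: dvdE)
      hence d: "d > 0" by (auto intro: gr0I)
      hence "g (Suc n div d, d) = real m powr (-\<rho>) * real d powr (real k + (-\<rho>))"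
        using m by (simp add: g_def)
      also have "\<dots> = real d ^ k * real (d * m) powr (-\<rho>)"
        unfolding powr_add using d by (simp add: powr_realpow powr_mult mult_ac)
      finally show "real d ^ k * real (Suc n) powr (-\<rho>) = g (Suc n div d, d)"
        using m by simp
    qed
    finally show "norm (norm (sigma_chi (of_nat k) chi psi (Suc n)) * real (Suc n) powr (-\<rho>)) \<le>
        (\<Sum>d | d dvd Suc n. g (Suc n div d, d))" by simp
  qed
qed

section \<open>Termwise integration of the two series\<close>

lemma bessel_sum_as_integral:
  assumes k: "k > 0" and chi: "\<And>n. norm (chi n) \<le> 1" and psi: "\<And>n. norm (psi n) \<le> 1"
    and nu: "Re \<nu> > 0" and b: "b > 0"
  shows "(\<lambda>n. sigma_chi (of_nat k) chi psi (Suc n) * (\<integral>v. bessel_kernel \<nu> (real (Suc n)) b v \<partial>lborel)) sums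
     (\<integral>v. exp (- \<nu> * of_real v - of_real (b * exp (- v))) *
        infsum (double_lambert k chi psi (exp v)) ({1..} \<times> {1..}) \<partial>lborel)"
proof -
  define \<sigma> where "\<sigma> n = sigma_chi (of_nat k) chi psi (Suc n)" for n
  define f where "f n v = \<sigma> n * bessel_kernel \<nu> (real (Suc n)) b v" for n v
  define E where "E v = exp (- \<nu> * of_real v - of_real (b * exp (- v)))" for v
  have f_eq: "f n v = E v * (\<sigma> n * of_real (exp (- (exp v * real (Suc n)))))" for n v
  proof -
    have "bessel_kernel \<nu> (real (Suc n)) b v =
        exp ((- \<nu> * of_real v - of_real (b * exp (- v))) + of_real (- (exp v * real (Suc n))))"
      unfolding bessel_kernel_def by (rule arg_cong[of _ _ exp]) (simp add: algebra_simps)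
    also have "\<dots> = E v * of_real (exp (- (exp v * real (Suc n))))"
      by (simp only: exp_add exp_of_real E_def)
    finally show ?thesis by (simp only: f_def mult_ac)
  qed
  have pw: "(\<lambda>n. f n v) sums (E v * infsum (double_lambert k chi psi (exp v)) ({1..} \<times> {1..}))" for v
    unfolding f_eq \<sigma>_def by (intro sums_mult sigma_chi_exp_sums(1)[OF k chi psi]) auto
  have "(\<lambda>n. integral\<^sup>L lborel (f n)) sums (\<integral>v. (\<Sum>n. f n v) \<partial>lborel)"
  proof (rule sums_integral)
    show "integrable lborel (f n)" for n
      unfolding f_def[abs_def] using nu b by (intro integrable_mult_right bessel_kernel_integrable) auto
    show "AE v in lborel. summable (\<lambda>n. norm (f n v))"
      unfolding f_eq \<sigma>_def norm_mult[of "E _"]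
      by (intro always_eventually allI summable_mult sigma_chi_exp_sums(2)[OF k chi psi]) auto
    \<comment> \<open>The divisor sum is at most n^(k+1), so decay of order k + 3 leaves a summable
      n^(-2).\<close>
    define N where "N = k + 3"
    define C where "C = fact N * (Gamma (Re \<nu> + real N) * b powr (- (Re \<nu> + real N)))"
    have C: "C \<ge> 0" unfolding C_def using nu by (intro mult_nonneg_nonneg less_imp_le[OF Gamma_real_pos]) auto
    have "summable (\<lambda>n. inverse (real (Suc n) ^ 2))"
      by (subst summable_Suc_iff) (rule inverse_power_summable, simp)
    hence "summable (\<lambda>n. C * inverse (real (Suc n) ^ 2))" by (rule summable_mult)
    thus "summable (\<lambda>n. \<integral>v. norm (f n v) \<partial>lborel)"
    proof (rule summable_comparison_test'[where N = 0])
      fix n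
      define c where "c = real (Suc n)"
      have c: "c > 0" by (simp add: c_def)
      have "(\<integral>v. norm (f n v) \<partial>lborel) = norm (\<sigma> n) * (\<integral>v. norm (bessel_kernel \<nu> c b v) \<partial>lborel)"
        unfolding f_def norm_mult c_def by simp
      also have "\<dots> \<le> c ^ (k + 1) * (C / c ^ N)"
      proof (rule mult_mono)
        show "norm (\<sigma> n) \<le> c ^ (k + 1)"
          using order.trans[OF sigma_chi_norm_le[OF k chi psi, where n = "Suc n"] sum_divisors_power_le]
          unfolding \<sigma>_def c_def by simp
        show "(\<integral>v. norm (bessel_kernel \<nu> c b v) \<partial>lborel) \<le> C / c ^ N"
          using bessel_kernel_integrable(2)[OF nu c b, of N] by (simp add: C_def)
      qed (use c in auto)
      also have "\<dots> = C * inverse (c ^ 2)"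
      proof -
        have "N = (k + 1) + 2" by (simp add: N_def)
        hence "c ^ N = c ^ (k + 1) * c ^ 2" by (simp only: power_add)
        thus ?thesis using c by (simp add: field_simps)
      qed
      finally show "norm (\<integral>v. norm (f n v) \<partial>lborel) \<le> C * inverse (real (Suc n) ^ 2)"
        by (simp add: c_def)
    qed
  qed
  moreover have "integral\<^sup>L lborel (f n) = \<sigma> n * (\<integral>v. bessel_kernel \<nu> (real (Suc n)) b v \<partial>lborel)" for n
    by (simp add: f_def[abs_def])
  ultimately show ?thesis using sums_unique[OF pw] by (simp only: \<sigma>_def E_def)
qed

text \<open>Here the L1 norms decay only like n^(-Re s). The bound n^(k+1) on the divisor sums would
  need Re s > k + 2, so \<open>summable_sigma_chi_powr\<close> is used: it reaches Re s > k + 1,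
  which is what Re \<nu> > 0 amounts to at s = \<nu> + k + 1.\<close>

lemma shifted_dirichlet_series_as_integral:
  assumes k: "k > 0" and chi: "\<And>n. norm (chi n) \<le> 1" and psi: "\<And>n. norm (psi n) \<le> 1"
    and s: "Re s > real k + 1" and b: "b > 0" and \<beta>: "\<beta> > 0"
  shows "(\<lambda>n. sigma_chi (of_nat k) chi psi (Suc n) * (Gamma s * of_real (\<beta> * real (Suc n) + b) powr (-s))) sums
     (\<integral>v. exp (- s * of_real v - of_real (b * exp (- v))) *
        infsum (double_lambert k chi psi (\<beta> * exp (- v))) ({1..} \<times> {1..}) \<partial>lborel)"
proof -
  define \<sigma> where "\<sigma> n = sigma_chi (of_nat k) chi psi (Suc n)" for n
  define B where "B n = \<beta> * real (Suc n) + b" for n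
  define h where "h n v = exp (- s * of_real v - of_real (B n * exp (- v)))" for n v
  define f where "f n v = \<sigma> n * h n v" for n v
  define E where "E v = exp (- s * of_real v - of_real (b * exp (- v)))" for v
  have B: "B n > 0" for n using b \<beta> by (simp add: B_def add_pos_pos)
  have s0: "Re s > 0" using s by linarith
  have f_eq: "f n v = E v * (\<sigma> n * of_real (exp (- (\<beta> * exp (- v) * real (Suc n)))))" for n v
  proof -
    have "h n v = exp ((- s * of_real v - of_real (b * exp (- v))) +
        of_real (- (\<beta> * exp (- v) * real (Suc n))))"
      unfolding h_def B_def by (rule arg_cong[of _ _ exp]) (simp add: algebra_simps)
    also have "\<dots> = E v * of_real (exp (- (\<beta> * exp (- v) * real (Suc n))))"
      by (simp only: exp_add exp_of_real E_def)
    finally show ?thesis by (simp only: f_def mult_ac)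
  qed
  have pw: "(\<lambda>n. f n v) sums (E v * infsum (double_lambert k chi psi (\<beta> * exp (- v))) ({1..} \<times> {1..}))" for v
    unfolding f_eq \<sigma>_def using \<beta> by (intro sums_mult sigma_chi_exp_sums(1)[OF k chi psi]) auto
  have hb: "has_bochner_integral lborel (h n) (Gamma s * of_real (B n) powr (-s))" for n
    unfolding h_def[abs_def] by (rule Gamma_integral_exp[OF s0 B])
  have "(\<lambda>n. integral\<^sup>L lborel (f n)) sums (\<integral>v. (\<Sum>n. f n v) \<partial>lborel)"
  proof (rule sums_integral)
    show "integrable lborel (f n)" for n
      unfolding f_def[abs_def] using hb by (intro integrable_mult_right) (simp add: has_bochner_integral_iff)
    show "AE v in lborel. summable (\<lambda>n. norm (f n v))"
      unfolding f_eq \<sigma>_def norm_mult[of "E _"] using \<beta>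
      by (intro always_eventually allI summable_mult sigma_chi_exp_sums(2)[OF k chi psi]) auto
    define C where "C = Gamma (Re s) * \<beta> powr (- Re s)"
    have "summable (\<lambda>n. C * (norm (\<sigma> n) * real (Suc n) powr (- Re s)))"
      unfolding \<sigma>_def by (intro summable_mult summable_sigma_chi_powr[OF k chi psi s])
    thus "summable (\<lambda>n. \<integral>v. norm (f n v) \<partial>lborel)"
    proof (rule summable_comparison_test'[where N = 0])
      fix n
      have G: "Gamma (Re s) > 0" using s0 by (rule Gamma_real_pos)
      have "(\<integral>v. norm (f n v) \<partial>lborel) = norm (\<sigma> n) * (Gamma (Re s) * B n powr (- Re s))"
        using Gamma_integral_exp_norm[OF s0 B, of n]
        unfolding f_def norm_mult h_def[symmetric] by (simp add: has_bochner_integral_iff)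
      also have "\<dots> \<le> norm (\<sigma> n) * (Gamma (Re s) * (\<beta> * real (Suc n)) powr (- Re s))"
        using G b \<beta> s0 unfolding B_def by (intro mult_left_mono powr_mono2') auto
      also have "\<dots> = C * (norm (\<sigma> n) * real (Suc n) powr (- Re s))"
        using \<beta> by (simp add: C_def powr_mult mult_ac)
      finally show "norm (\<integral>v. norm (f n v) \<partial>lborel) \<le> C * (norm (\<sigma> n) * real (Suc n) powr (- Re s))"
        by simp
    qed
  qed
  moreover have "integral\<^sup>L lborel (f n) = \<sigma> n * (Gamma s * of_real (B n) powr (-s))" for n
    using hb[of n] by (simp add: f_def[abs_def] has_bochner_integral_iff)
  ultimately show ?thesis using sums_unique[OF pw] by (simp only: \<sigma>_def E_def B_def)
qed

section \<open>The constants and the final assembly\<close>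

text \<open>The left side collects b^(\<nu>/2) / 2 from the Bessel integral, (2 \<pi> / q)^(k+1) / p
  from the transformation law and \<beta>^(-s) from the Gamma integrals. All bases are positive, so
  every factor is the exponential of a combination of real logarithms and only the exponents are
  compared.\<close>

lemma transformation_constant:
  fixes a x p q :: real and \<nu> :: complex and k :: nat
  assumes pos: "a > 0" "x > 0" "p > 0" "q > 0"
  shows "of_real (a\<^sup>2 * x / 4) powr (\<nu> / 2) / 2 * (of_real (2 * pi / q) ^ Suc k / of_real p) *
       of_real (4 * pi\<^sup>2 / (p * q)) powr (- (\<nu> + of_nat k + 1)) =
     of_real (a * q) powr \<nu> * of_real p powr (\<nu> + of_nat k) * of_real x powr (\<nu> / 2)
       / (2 powr (3 * \<nu> + of_nat k + 2) * of_real pi powr (2 * \<nu> + of_nat k + 1))"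
proof -
  define A X P Q L T where "A = complex_of_real (ln a)" and "X = complex_of_real (ln x)"
    and "P = complex_of_real (ln p)" and "Q = complex_of_real (ln q)"
    and "L = complex_of_real (ln 2)" and "T = complex_of_real (ln pi)"
  have pw: "complex_of_real r powr z = exp (z * of_real (ln r))" if "r > 0" for r z
    using that by (simp add: powr_def Ln_of_real)
  have "ln (4::real) = 2 * ln 2" using ln_realpow[of "2::real" 2] by simp
  hence lns: "complex_of_real (ln (a\<^sup>2 * x / 4)) = 2 * A + X - 2 * L"
    "complex_of_real (ln (4 * pi\<^sup>2 / (p * q))) = 2 * L + 2 * T - P - Q"
    "complex_of_real (ln (a * q)) = A + Q"
    "complex_of_real (ln (2 * pi / q)) = L + T - Q"
    using pos by (simp_all add: A_def X_def P_def Q_def L_def T_def ln_mult ln_div ln_realpow)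
  have pos': "a\<^sup>2 * x / 4 > 0" "4 * pi\<^sup>2 / (p * q) > 0" "a * q > 0" using pos by simp_all
  note e1 = pw[OF pos'(1), of "\<nu> / 2", unfolded lns]
    and e2 = pw[OF pos'(2), of "- (\<nu> + of_nat k + 1)", unfolded lns]
    and e3 = pw[OF pos'(3), of \<nu>, unfolded lns]
    and e4 = pw[OF pos(3), of "\<nu> + of_nat k", folded P_def]
    and e5 = pw[OF pos(2), of "\<nu> / 2", folded X_def]
    and e6 = pw[OF pi_gt_zero, of "2 * \<nu> + of_nat k + 1", folded T_def]
  have ex: "complex_of_real r = exp (of_real (ln r))" if "r > 0" for r
    using that by (simp add: exp_of_real)
  have "2 * pi / q > 0" using pos by simp
  from ex[OF this, unfolded lns] have e8: "of_real (2 * pi / q) ^ Suc k = exp (of_nat (Suc k) * (L + T - Q))"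
    by (simp only: exp_of_nat_mult)
  \<comment> \<open>The plain factor 1/2 is also written as an exponential, so that it merges with
    the powers of 2.\<close>
  have e9: "of_real p = exp P" and e10: "(2::complex) = exp L"
    using ex[OF pos(3)] ex[of 2] by (simp_all add: P_def L_def)
  have e7: "2 powr (3 * \<nu> + of_nat k + 2) = exp ((3 * \<nu> + of_nat k + 2) * L)"
    using pw[of 2] by (simp add: L_def)
  have "of_real (a\<^sup>2 * x / 4) powr (\<nu> / 2) / 2 * (of_real (2 * pi / q) ^ Suc k / of_real p) *
       of_real (4 * pi\<^sup>2 / (p * q)) powr (- (\<nu> + of_nat k + 1)) =
     exp (\<nu> / 2 * (2 * A + X - 2 * L)) / exp L * (exp (of_nat (Suc k) * (L + T - Q)) / exp P) *
       exp (- (\<nu> + of_nat k + 1) * (2 * L + 2 * T - P - Q))"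
    unfolding e1 e2 e8 e9 e10[symmetric] by (simp only:)
  also have "\<dots> = exp (\<nu> * (A + Q)) * exp ((\<nu> + of_nat k) * P) * exp (\<nu> / 2 * X) /
      (exp ((3 * \<nu> + of_nat k + 2) * L) * exp ((2 * \<nu> + of_nat k + 1) * T))"
    unfolding exp_add[symmetric] exp_diff[symmetric]
    by (rule arg_cong[of _ _ exp]) (simp add: field_simps)
  finally show ?thesis unfolding e3 e4 e5 e6 e7 .
qed

text \<open>Convergence of the right-hand series is a conjunct of its own, since
  \<open>suminf\<close> alone would not assert it; for the left-hand series it is part of
  \<open>sums\<close>. \<open>Suc\<close> makes the indices start at 1.\<close>

theorem theorem2p10:
  fixes k p q :: nat and chi1 chi2 :: "int \<Rightarrow> complex" and a x :: real and \<nu> :: complex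
  assumes "k \<ge> 1" and "odd k"
    and "primitive_character p chi1" and "primitive_character q chi2"
    and "(even_character chi1 \<and> even_character chi2 \<and>
          \<not> principal_character p chi1 \<and> \<not> principal_character q chi2)
         \<or> (odd_character chi1 \<and> odd_character chi2)"
    and "a > 0" and "x > 0" and "Re \<nu> > 0"
  shows "summable (\<lambda>m. sigma_chi (of_nat k) (\<lambda>n. cnj (chi2 n)) (\<lambda>n. cnj (chi1 n)) (Suc m)
              / of_real (real (Suc m) + a\<^sup>2 * real p * real q * x / (16 * pi\<^sup>2)) powr (\<nu> + of_nat k + 1))
    \<and> (\<lambda>m. sigma_chi (of_nat k) chi1 chi2 (Suc m) * of_nat (Suc m) powr (\<nu> / 2)
              * besselK \<nu> (a * sqrt (real (Suc m) * x)))
      sums ((-1) ^ ((k + 1) div 2) * of_real (a * real q) powr \<nu> * of_nat p powr (\<nu> + of_nat k)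
              * of_real x powr (\<nu> / 2)
            / (2 powr (3 * \<nu> + of_nat k + 2) * of_real pi powr (2 * \<nu> + of_nat k + 1))
            * gauss_sum p chi1 * gauss_sum q chi2 * Gamma (\<nu> + of_nat k + 1)
            * (\<Sum>m. sigma_chi (of_nat k) (\<lambda>n. cnj (chi2 n)) (\<lambda>n. cnj (chi1 n)) (Suc m)
              / of_real (real (Suc m) + a\<^sup>2 * real p * real q * x / (16 * pi\<^sup>2)) powr (\<nu> + of_nat k + 1)))"
proof -
  have k: "k > 0" using assms(1) by simp
  have d1: "dirichlet_character p chi1" and d2: "dirichlet_character q chi2"
    using assms(3,4) by (auto simp: primitive_character_def)
  \<comment> \<open>A character modulo 1 is constantly 1, hence principal and not odd, so either
    parity case excludes it.\<close>
  have p1: "p \<noteq> 1" and q1: "q \<noteq> 1"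
    using assms(5) d1 d2 dirichlet_character_mod_1[of chi1] dirichlet_character_mod_1[of chi2]
    by (auto simp: principal_character_def odd_character_def)
  have p: "p > 0" and q: "q > 0" using d1 d2 by (auto simp: dirichlet_character_def)
  have parity: "chi1 (-1) = chi2 (-1)" "chi1 (-1) \<in> {1, -1}"
    using assms(5) by (auto simp: even_character_def odd_character_def)
  note le1 = dirichlet_character_norm_le[OF d1] and le2 = dirichlet_character_norm_le[OF d2]
  have le1': "norm (cnj (chi1 n)) \<le> 1" and le2': "norm (cnj (chi2 n)) \<le> 1" for n
    using le1 le2 by simp_all
  define P where "P = {1::nat..} \<times> {1::nat..}"
  define c1 c2 where "c1 = (\<lambda>n. cnj (chi1 n))" and "c2 = (\<lambda>n. cnj (chi2 n))"
  define \<sigma> where "\<sigma> n = sigma_chi (of_nat k) chi1 chi2 (Suc n)" for n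
  define \<sigma>' where "\<sigma>' n = sigma_chi (of_nat k) c2 c1 (Suc n)" for n
  define b where "b = a\<^sup>2 * x / 4"
  \<comment> \<open>For y = exp v / (2 \<pi>) the dual argument 2 \<pi> / (p q y) is \<beta>
    exp(-v).\<close>
  define \<beta> where "\<beta> = 4 * pi\<^sup>2 / (real p * real q)"
  \<comment> \<open>This is b / \<beta>, the shift that remains when \<beta> is taken out of \<beta>
    n + b.\<close>
  define X where "X = a\<^sup>2 * real p * real q * x / (16 * pi\<^sup>2)"
  define s where "s = \<nu> + of_nat k + 1"
  define \<tau> where "\<tau> = gauss_sum p chi1 * gauss_sum q chi2"
  define D where "D = (-1) ^ ((k + 1) div 2) * (of_real (2 * pi / real q) ^ Suc k / of_nat p) * \<tau>"
  define F where "F v = exp (- \<nu> * of_real v - of_real (b * exp (- v))) *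
      infsum (double_lambert k chi1 chi2 (exp v)) P" for v
  define G where "G v = exp (- s * of_real v - of_real (b * exp (- v))) *
      infsum (double_lambert k c2 c1 (\<beta> * exp (- v))) P" for v
  define Z where "Z n = \<sigma>' n / of_real (real (Suc n) + X) powr s" for n
  have b: "b > 0" and \<beta>: "\<beta> > 0" and X: "X > 0"
    using assms(6,7) p q by (simp_all add: b_def \<beta>_def X_def)
  have s: "Re s > real k + 1" using assms(8) by (simp add: s_def)
  \<comment> \<open>The transformation law makes the integrands proportional pointwise: its factor
    exp(-(k+1) v) raises the exponent \<nu> to \<open>s\<close>, and the rest is the constant
    \<open>D\<close>, with sign i^(-k-1) = (-1)^((k+1)/2).\<close>
  have FG: "F v = D * G v" for v
  proof -
    define y where "y = exp v / (2 * pi)"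
    have y: "y > 0" by (simp add: y_def)
    have t: "2 * pi * y = exp v" "2 * pi * (1 / (real p * real q * y)) = \<beta> * exp (- v)"
      using p q by (simp_all add: y_def \<beta>_def exp_minus field_simps power2_eq_square)
    have pow: "inverse ((\<i> * of_real (y * real q)) ^ Suc k) =
        (-1) ^ ((k + 1) div 2) * of_real (2 * pi / real q) ^ Suc k * exp (- of_nat (Suc k) * of_real v)"
    proof -
      obtain j where j: "Suc k = 2 * j" using assms(2) by (metis evenE even_Suc)
      have "inverse (\<i> ^ Suc k) = (-1) ^ ((k + 1) div 2)"
        unfolding j by (simp add: power_mult j flip: power_inverse)
      moreover have "inverse (of_real (y * real q)) = of_real (2 * pi / real q) * exp (- complex_of_real v)"
        using q by (simp add: y_def exp_minus exp_of_real field_simps)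
      ultimately show ?thesis
        by (simp only: power_mult_distrib inverse_mult_distrib power_inverse[symmetric]
            exp_of_nat_mult[symmetric] mult_minus_left mult_minus_right mult.assoc)
    qed
    have "of_nat p * infsum (double_lambert k chi1 chi2 (exp v)) P =
        inverse ((\<i> * of_real (y * real q)) ^ Suc k) * \<tau> * infsum (double_lambert k c2 c1 (\<beta> * exp (- v))) P"
      using double_lambert_transformation[OF assms(3) p1 assms(4) q1 parity y assms(2)]
      unfolding t P_def \<tau>_def c1_def c2_def by (simp only: mult.assoc)
    hence "infsum (double_lambert k chi1 chi2 (exp v)) P =
        inverse ((\<i> * of_real (y * real q)) ^ Suc k) * \<tau> * infsum (double_lambert k c2 c1 (\<beta> * exp (- v))) P / of_nat p"
      using p by (metis nonzero_mult_div_cancel_left of_nat_0_eq_iff less_irrefl)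
    also have "\<dots> = D * exp (- of_nat (Suc k) * of_real v) * infsum (double_lambert k c2 c1 (\<beta> * exp (- v))) P"
      unfolding pow D_def by (simp only: times_divide_eq_left times_divide_eq_right mult_ac)
    finally have "infsum (double_lambert k chi1 chi2 (exp v)) P =
        D * exp (- of_nat (Suc k) * of_real v) * infsum (double_lambert k c2 c1 (\<beta> * exp (- v))) P" .
    moreover have "exp (- \<nu> * of_real v - of_real (b * exp (- v))) * exp (- of_nat (Suc k) * of_real v) =
        exp (- s * of_real v - of_real (b * exp (- v)))"
      unfolding exp_add[symmetric] by (rule arg_cong[of _ _ exp]) (simp add: s_def algebra_simps)
    ultimately have "G v = exp (- \<nu> * of_real v - of_real (b * exp (- v))) *
        exp (- of_nat (Suc k) * of_real v) * infsum (double_lambert k c2 c1 (\<beta> * exp (- v))) P"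
      and "F v = exp (- \<nu> * of_real v - of_real (b * exp (- v))) * (D *
        exp (- of_nat (Suc k) * of_real v) * infsum (double_lambert k c2 c1 (\<beta> * exp (- v))) P)"
      by (simp_all only: F_def G_def)
    thus ?thesis by (simp only: mult_ac)
  qed
  have "(\<lambda>n. \<sigma>' n * (Gamma s * of_real (\<beta> * real (Suc n) + b) powr (-s))) sums integral\<^sup>L lborel G"
    unfolding \<sigma>'_def G_def[abs_def] P_def c1_def c2_def
    by (rule shifted_dirichlet_series_as_integral[OF k le2' le1' s b \<beta>])
  moreover have "\<sigma>' n * (Gamma s * of_real (\<beta> * real (Suc n) + b) powr (-s)) =
      Gamma s * of_real \<beta> powr (-s) * Z n" for n
  proof -
    define u where "u = real (Suc n) + X"
    have u: "u > 0" using X by (simp add: u_def)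
    have "\<beta> * real (Suc n) + b = \<beta> * u"
      using p q by (simp add: \<beta>_def b_def X_def u_def field_simps)
    moreover have "of_real (\<beta> * u) powr (-s) = of_real \<beta> powr (-s) * of_real u powr (-s)"
      using \<beta> u by (simp add: powr_times_real)
    ultimately show ?thesis
      unfolding Z_def u_def[symmetric] by (simp add: powr_minus divide_inverse mult_ac)
  qed
  ultimately have Zs: "(\<lambda>n. Gamma s * of_real \<beta> powr (-s) * Z n) sums integral\<^sup>L lborel G" by (simp only:)
  \<comment> \<open>\<open>Gamma\<close> takes the value 0 exactly at its poles, so it suffices that
    \<open>s\<close> is not a nonpositive integer. Convergence of the series \<open>Z\<close>
    follows by dividing out this factor.\<close>
  have nz: "Gamma s * of_real \<beta> powr (-s) \<noteq> 0"
  proof -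
    have "s \<notin> \<int>\<^sub>\<le>\<^sub>0" using s by (auto elim!: nonpos_Ints_cases)
    thus ?thesis using \<beta> by (simp add: Gamma_eq_zero_iff)
  qed
  have Z: "summable Z" using sums_summable[OF Zs] nz by (simp add: summable_cmult_iff)
  have intG: "integral\<^sup>L lborel G = Gamma s * of_real \<beta> powr (-s) * suminf Z"
    using sums_unique[OF Zs] Z by (simp add: suminf_mult)
  have "(\<lambda>n. \<sigma> n * (\<integral>v. bessel_kernel \<nu> (real (Suc n)) b v \<partial>lborel)) sums integral\<^sup>L lborel F"
    unfolding \<sigma>_def F_def[abs_def] P_def
    by (rule bessel_sum_as_integral[OF k le1 le2 assms(8) b])
  hence "(\<lambda>n. of_real b powr (\<nu> / 2) / 2 * (\<sigma> n * (\<integral>v. bessel_kernel \<nu> (real (Suc n)) b v \<partial>lborel))) sums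
      (of_real b powr (\<nu> / 2) / 2 * integral\<^sup>L lborel F)"
    by (rule sums_mult)
  moreover have "of_real b powr (\<nu> / 2) / 2 * (\<sigma> n * (\<integral>v. bessel_kernel \<nu> (real (Suc n)) b v \<partial>lborel)) =
      \<sigma> n * of_nat (Suc n) powr (\<nu> / 2) * besselK \<nu> (a * sqrt (real (Suc n) * x))" for n
  proof -
    have "real (Suc n) * b = (a / 2)\<^sup>2 * (real (Suc n) * x)"
      by (simp add: b_def power_divide)
    hence "2 * sqrt (real (Suc n) * b) = a * sqrt (real (Suc n) * x)"
      using assms(6) by (simp only: real_sqrt_mult real_sqrt_abs abs_of_pos)
    hence "of_nat (Suc n) powr (\<nu> / 2) * besselK \<nu> (a * sqrt (real (Suc n) * x)) =
        of_real b powr (\<nu> / 2) * (\<integral>v. bessel_kernel \<nu> (real (Suc n)) b v \<partial>lborel) / 2"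
      using besselK_scaled[OF assms(8) _ b, of "real (Suc n)"] by (simp del: of_nat_Suc)
    thus ?thesis by (simp add: mult.assoc)
  qed
  moreover have "of_real b powr (\<nu> / 2) / 2 * integral\<^sup>L lborel F =
      (-1) ^ ((k + 1) div 2) * of_real (a * real q) powr \<nu> * of_nat p powr (\<nu> + of_nat k) * of_real x powr (\<nu> / 2)
        / (2 powr (3 * \<nu> + of_nat k + 2) * of_real pi powr (2 * \<nu> + of_nat k + 1))
        * gauss_sum p chi1 * gauss_sum q chi2 * Gamma s * suminf Z"
  proof -
    have "of_real b powr (\<nu> / 2) / 2 * integral\<^sup>L lborel F =
        (-1) ^ ((k + 1) div 2) * (of_real b powr (\<nu> / 2) / 2 *
          (of_real (2 * pi / real q) ^ Suc k / of_real (real p)) * of_real \<beta> powr (- s)) * \<tau> * Gamma s * suminf Z"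
      unfolding FG[abs_def] by (simp add: intG D_def mult_ac)
    also have "of_real b powr (\<nu> / 2) / 2 * (of_real (2 * pi / real q) ^ Suc k / of_real (real p)) * of_real \<beta> powr (- s) =
        of_real (a * real q) powr \<nu> * of_real (real p) powr (\<nu> + of_nat k) * of_real x powr (\<nu> / 2)
        / (2 powr (3 * \<nu> + of_nat k + 2) * of_real pi powr (2 * \<nu> + of_nat k + 1))"
      unfolding b_def \<beta>_def s_def using assms(6,7) p q by (intro transformation_constant) auto
    finally show ?thesis by (simp only: \<tau>_def mult.assoc times_divide_eq_right times_divide_eq_left of_real_of_nat_eq)
  qed
  ultimately have "(\<lambda>n. \<sigma> n * of_nat (Suc n) powr (\<nu> / 2) * besselK \<nu> (a * sqrt (real (Suc n) * x))) sums
     ((-1) ^ ((k + 1) div 2) * of_real (a * real q) powr \<nu> * of_nat p powr (\<nu> + of_nat k) * of_real x powr (\<nu> / 2)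
        / (2 powr (3 * \<nu> + of_nat k + 2) * of_real pi powr (2 * \<nu> + of_nat k + 1))
        * gauss_sum p chi1 * gauss_sum q chi2 * Gamma s * suminf Z)"
    by (simp only:)
  with Z show ?thesis
    unfolding Z_def[abs_def] \<sigma>_def \<sigma>'_def X_def s_def c1_def c2_def by (rule conjI)
qed

end
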